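(* Let $V=\{1,\dots,m\}$ with $m\ge 2$, and let $\mathsf{Z}_V=(\mathsf{Z}_i\mid i\in V)$ be a finite linear source over a finite field $\mathbb{F}_q$, where, for each $i\in V$, $\mathsf{Z}_i$ is equivalent up to bijection to $\boldsymbol{\mathsf{x}}\boldsymbol{M}_i$, with $\boldsymbol{\mathsf{x}}$ a uniformly random row vector over $\mathbb{F}_q$ and $\boldsymbol{M}_i$ a deterministic matrix over $\mathbb{F}_q$. Then $$C_{\mathrm S}(0)=J_{\mathrm{GK}}(\mathsf{Z}_V),$$ where $C_{\mathrm S}(0)$ is the secrecy capacity at asymptotically zero discussion rate and $J_{\mathrm{GK}}(\mathsf{Z}_V)$ is the multivariate Gács–Körner common information. Moreover, an optimal solution to the maximization defining $J_{\mathrm{GK}}(\mathsf{Z}_V)$ is $$\mathsf{G}=\boldsymbol{\mathsf{x}}\boldsymbol{M},$$ where $\boldsymbol{M}$ is a matrix over $\mathbb{F}_q$ whose column space is $\langle\boldsymbol{M}\rangle=\bigcap_{i\in V}\langle\boldsymbol{M}_i\rangle$, the intersection of the column spaces of all the $\boldsymbol{M}_i$'s; $\langle\boldsymbol{M}\rangle$ is also the maximum common subspace $\arg\max_{S}\{\dim S\mid S\subseteq\langle\boldsymbol{M}_i\rangle\ \forall i\in V\}$, with $S$ ranging over linear subspaces.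
   Context: All entropies and logarithms use the same fixed base. $\langle\boldsymbol{A}\rangle$ denotes the column space of a matrix $\boldsymbol{A}$. Source and secret key agreement. $V=\{1,\dots,m\}$, $m\ge2$, is the set of users; $\mathsf{Z}_V=(\mathsf{Z}_i\mid i\in V)$ is a tuple of random variables with joint distribution $P_{\mathsf{Z}_V}$ on a finite alphabet $\prod_{i\in V}Z_i$. A secret key agreement scheme, for each block length $n$, is as follows. Each user $i\in V$ generates a private (discrete) random variable $\mathsf{U}_i$, with $P_{\mathsf{U}_V}=\prod_{i\in V}P_{\mathsf{U}_i}$, and observes $\mathsf{Z}_i^n$, where $\mathsf{Z}_V^n$ is an i.i.d. sequence of $n$ copies of $\mathsf{Z}_V$, independent of $\mathsf{U}_V$. Write $\tilde{\mathsf{Z}}_i:=(\mathsf{U}_i,\mathsf{Z}_i^n)$. The users discuss interactively in public over multiple rounds: in round $t=1,2,\dots$ some user $i_t\in V$ broadcasts $\mathsf{F}_t=f_t(\mathsf{F}^{t-1},\tilde{\mathsf{Z}}_{i_t})$, where $f_t$ is a function and $\mathsf{F}^{t-1}=(\mathsf{F}_\tau\mid \tau<t)$. The whole discussion is $\mathsf{F}=(\mathsf{F}_1,\mathsf{F}_2,\dots)$, with finite alphabet $F$. A secret key $\mathsf{K}$ is a random variable with finite alphabet $K$ (all quantities depend on $n$) satisfying, for some functions $\phi_i$, $i\in V$, $$\lim_{n\to\infty}\Pr\big(\exists i\in V,\ \mathsf{K}\ne\phi_i(\mathsf{F},\tilde{\mathsf{Z}}_i)\big)=0 \quad\text{(recoverability)},$$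 $$\limsup_{n\to\infty}\tfrac1n\big[\log|K|-H(\mathsf{K}\mid\mathsf{F})\big]=0\quad\text{(secrecy)}.$$ For $R\ge0$, the secrecy capacity $C_{\mathrm S}(R)$ is the supremum of $\liminf_{n\to\infty}\frac1n\log|K|$ over all such (sequences of) schemes that satisfy $\limsup_{n\to\infty}\frac1n\log|F|\le R$. Gács–Körner common information. $$J_{\mathrm{GK}}(\mathsf{Z}_V):=\max\{H(\mathsf{G})\mid H(\mathsf{G}\mid\mathsf{Z}_i)=0\ \ \forall i\in V\}.$$ Finite linear source. $\mathsf{Z}_V$ is a finite linear source if, for every $i\in V$, $\mathsf{Z}_i$ is equivalent up to bijection to $\boldsymbol{\mathsf{x}}\boldsymbol{M}_i$, where $\boldsymbol{\mathsf{x}}$ is a random row vector uniformly distributed over $\mathbb{F}_q^{\ell}$ for some finite field $\mathbb{F}_q$ and some length $\ell$ (the same $\boldsymbol{\mathsf{x}}$ for all $i$), and $\boldsymbol{M}_i$ is a deterministic matrix with $\ell$ rows and entries in $\mathbb{F}_q$. Two random variables $\mathsf{A},\mathsf{B}$ are equivalent up to bijection if $H(\mathsf{A}\mid\mathsf{B})=H(\mathsf{B}\mid\mathsf{A})=0$. *)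

theory Defs
  imports "HOL-Probability.Probability" "Jordan_Normal_Form.VS_Connect"
begin

section \<open>Entropy of discrete random variables\<close>

text \<open>These abbreviations unfold to the notations for entropy and conditional entropy of the
  locale \<^locale>\<open>information_space\<close>, with the probability space and the base of the logarithm made
  explicit. They are only used for random variables of finite range.\<close>

abbreviation rv_entropy :: "real \<Rightarrow> 'w measure \<Rightarrow> ('w \<Rightarrow> 'a) \<Rightarrow> real" where
  "rv_entropy b M X \<equiv> prob_space.entropy M b (count_space (X ` space M)) X"

abbreviation rv_cond_entropy ::
    "real \<Rightarrow> 'w measure \<Rightarrow> ('w \<Rightarrow> 'a) \<Rightarrow> ('w \<Rightarrow> 'c) \<Rightarrow> real" where
  "rv_cond_entropy b M X Y \<equiv>
     prob_space.conditional_entropy M b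
       (count_space (X ` space M)) (count_space (Y ` space M)) X Y"

definition equivalent_rv ::
    "real \<Rightarrow> 'w measure \<Rightarrow> ('w \<Rightarrow> 'a) \<Rightarrow> ('w \<Rightarrow> 'c) \<Rightarrow> bool" where
  "equivalent_rv b M X Y \<longleftrightarrow> rv_cond_entropy b M X Y = 0 \<and> rv_cond_entropy b M Y X = 0"


section \<open>Secret key agreement\<close>

text \<open>A scheme for one block length. All random variables of a scheme are discrete and there are
  finitely many of them, so they can be realised on a sample space with countably many points;
  the sample space is therefore taken to be \<^typ>\<open>nat\<close>, and likewise the alphabets of the private
  randomness, the individual messages and the key are taken to be sets of natural numbers.
  The key \<open>sk_key\<close> is an arbitrary random variable on the sample space; it need not be a function
  of the private randomness and the source. Rounds and time instants are counted from \<open>0\<close>.\<close>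

record 'z sk_scheme =
  sk_law :: "nat pmf"
  sk_priv :: "nat \<Rightarrow> nat \<Rightarrow> nat"  \<comment> \<open>user, sample point\<close>
  sk_obs :: "nat \<Rightarrow> nat \<Rightarrow> nat \<Rightarrow> 'z"  \<comment> \<open>user, time instant, sample point\<close>
  sk_speaker :: "nat \<Rightarrow> nat"
  sk_enc :: "nat \<Rightarrow> nat list \<Rightarrow> nat \<times> 'z list \<Rightarrow> nat"
    \<comment> \<open>round, previous messages, observation of the speaker\<close>
  sk_disc_alph :: "(nat \<Rightarrow> nat) set"
  sk_key :: "nat \<Rightarrow> nat"
  sk_key_alph :: "nat set"
  sk_dec :: "nat \<Rightarrow> (nat \<Rightarrow> nat) \<Rightarrow> nat \<times> 'z list \<Rightarrow> nat"
    \<comment> \<open>user, whole discussion, observation of the user\<close>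

text \<open>The observation of user \<open>i\<close>: the private randomness and the block of \<open>n\<close> source symbols.\<close>

definition user_obs :: "nat \<Rightarrow> 'z sk_scheme \<Rightarrow> nat \<Rightarrow> nat \<Rightarrow> nat \<times> 'z list" where
  "user_obs n S i \<omega> = (sk_priv S i \<omega>, map (\<lambda>t. sk_obs S i t \<omega>) [0..<n])"

text \<open>The message of round \<open>t\<close>, when user \<open>i\<close> observes \<open>y i\<close>.\<close>

fun message ::
    "(nat \<Rightarrow> nat list \<Rightarrow> 'y \<Rightarrow> nat) \<Rightarrow> (nat \<Rightarrow> nat) \<Rightarrow> (nat \<Rightarrow> 'y) \<Rightarrow> nat \<Rightarrow> nat" where
  "message f sp y t = f t (map (message f sp y) [0..<t]) (y (sp t))"

declare message.simps [simp del]

text \<open>The whole discussion is the sequence of all messages. The number of rounds is not bounded a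
  priori: a discussion with finitely many rounds is one whose later messages are constant, and this
  affects neither the alphabet size nor any entropy.\<close>

definition discussion :: "nat \<Rightarrow> 'z sk_scheme \<Rightarrow> nat \<Rightarrow> (nat \<Rightarrow> nat)" where
  "discussion n S \<omega> = message (sk_enc S) (sk_speaker S) (\<lambda>i. user_obs n S i \<omega>)"

text \<open>\<open>S\<close> is a scheme of block length \<open>n\<close> for the users \<open>V\<close> and the source \<open>(Z i | i \<in> V)\<close> on the
  probability space \<open>M\<close>. Only the joint distribution of the source matters.\<close>

definition valid_scheme ::
    "nat set \<Rightarrow> 'w measure \<Rightarrow> (nat \<Rightarrow> 'w \<Rightarrow> 'z) \<Rightarrow> nat \<Rightarrow> 'z sk_scheme \<Rightarrow> bool" where
  "valid_scheme V M Z n S \<longleftrightarrow>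
     prob_space.indep_vars (measure_pmf (sk_law S)) (\<lambda>_. count_space UNIV) (sk_priv S) V \<and>
     prob_space.indep_vars (measure_pmf (sk_law S)) (\<lambda>_. count_space UNIV)
       (\<lambda>t \<omega>. \<lambda>i\<in>V. sk_obs S i t \<omega>) {..<n} \<and>
     (\<forall>t<n. distr (measure_pmf (sk_law S)) (count_space UNIV) (\<lambda>\<omega>. \<lambda>i\<in>V. sk_obs S i t \<omega>) =
            distr M (count_space UNIV) (\<lambda>\<omega>. \<lambda>i\<in>V. Z i \<omega>)) \<and>
     map_pmf (\<lambda>\<omega>. (\<lambda>i\<in>V. sk_priv S i \<omega>, \<lambda>t\<in>{..<n}. \<lambda>i\<in>V. sk_obs S i t \<omega>)) (sk_law S) =
       pair_pmf (map_pmf (\<lambda>\<omega>. \<lambda>i\<in>V. sk_priv S i \<omega>) (sk_law S))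
                (map_pmf (\<lambda>\<omega>. \<lambda>t\<in>{..<n}. \<lambda>i\<in>V. sk_obs S i t \<omega>) (sk_law S)) \<and>
     (\<forall>t. sk_speaker S t \<in> V) \<and>
     finite (sk_disc_alph S) \<and> (\<forall>\<omega>. discussion n S \<omega> \<in> sk_disc_alph S) \<and>
     finite (sk_key_alph S) \<and> (\<forall>\<omega>. sk_key S \<omega> \<in> sk_key_alph S)"

definition recoverable :: "nat set \<Rightarrow> (nat \<Rightarrow> 'z sk_scheme) \<Rightarrow> bool" where
  "recoverable V S \<longleftrightarrow>
     (\<lambda>n. measure_pmf.prob (sk_law (S n))
            {\<omega>. \<exists>i\<in>V. sk_key (S n) \<omega> \<noteq>
                       sk_dec (S n) i (discussion n (S n) \<omega>) (user_obs n (S n) i \<omega>)})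
     \<longlonglongrightarrow> 0"

definition secret :: "real \<Rightarrow> (nat \<Rightarrow> 'z sk_scheme) \<Rightarrow> bool" where
  "secret b S \<longleftrightarrow>
     limsup (\<lambda>n. ereal ((log b (real (card (sk_key_alph (S n)))) -
       rv_cond_entropy b (measure_pmf (sk_law (S n))) (sk_key (S n)) (discussion n (S n)))
         / real n)) = 0"

text \<open>At \<open>n = 0\<close> a division by zero gives \<open>0\<close> and a trivial scheme is always available, so this
  index plays no role in what follows.\<close>

definition secrecy_capacity ::
    "real \<Rightarrow> nat set \<Rightarrow> 'w measure \<Rightarrow> (nat \<Rightarrow> 'w \<Rightarrow> 'z) \<Rightarrow> real \<Rightarrow> ereal" where
  "secrecy_capacity b V M Z R =
     (SUP S \<in> {S. (\<forall>n. valid_scheme V M Z n (S n)) \<and> recoverable V S \<and> secret b S \<and>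
                  limsup (\<lambda>n. ereal (log b (real (card (sk_disc_alph (S n)))) / real n))
                    \<le> ereal R}.
        liminf (\<lambda>n. ereal (log b (real (card (sk_key_alph (S n)))) / real n)))"


section \<open>Multivariate Gacs-Korner common information\<close>

definition common_rv ::
    "real \<Rightarrow> nat set \<Rightarrow> 'w measure \<Rightarrow> (nat \<Rightarrow> 'w \<Rightarrow> 'z) \<Rightarrow> ('w \<Rightarrow> 'g) \<Rightarrow> bool" where
  "common_rv b V M Z G \<longleftrightarrow>
     simple_function M G \<and> (\<forall>i\<in>V. rv_cond_entropy b M G (Z i) = 0)"

text \<open>A common random variable has finite range, so up to relabelling, which preserves all
  entropies, its values are natural numbers.\<close>

definition J_GK ::
    "real \<Rightarrow> nat set \<Rightarrow> 'w measure \<Rightarrow> (nat \<Rightarrow> 'w \<Rightarrow> 'z) \<Rightarrow> ereal" where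
  "J_GK b V M Z =
     (SUP G \<in> {G :: 'w \<Rightarrow> nat. common_rv b V M Z G}. ereal (rv_entropy b M G))"

definition GK_optimal ::
    "real \<Rightarrow> nat set \<Rightarrow> 'w measure \<Rightarrow> (nat \<Rightarrow> 'w \<Rightarrow> 'z) \<Rightarrow> ('w \<Rightarrow> 'g) \<Rightarrow> bool" where
  "GK_optimal b V M Z G \<longleftrightarrow>
     common_rv b V M Z G \<and> ereal (rv_entropy b M G) = J_GK b V M Z"


section \<open>Finite linear sources\<close>

text \<open>Vectors carry no orientation: the row vector \<open>x A\<close> is the transpose of \<open>A\<close> applied to \<open>x\<close>.\<close>

definition row_times :: "'q :: semiring_0 vec \<Rightarrow> 'q mat \<Rightarrow> 'q vec" where
  "row_times x A = mult_mat_vec (transpose_mat A) x"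

definition finite_linear_source ::
    "real \<Rightarrow> nat set \<Rightarrow> 'w measure \<Rightarrow> (nat \<Rightarrow> 'w \<Rightarrow> 'z) \<Rightarrow>
     nat \<Rightarrow> ('w \<Rightarrow> 'q :: {field, finite} vec) \<Rightarrow> (nat \<Rightarrow> 'q mat) \<Rightarrow> bool" where
  "finite_linear_source b V M Z l x A \<longleftrightarrow>
     (\<forall>i\<in>V. simple_function M (Z i)) \<and>
     x \<in> measurable M (count_space (carrier_vec l)) \<and>
     distr M (count_space (carrier_vec l)) x = uniform_count_measure (carrier_vec l) \<and>
     (\<forall>i\<in>V. dim_row (A i) = l \<and> equivalent_rv b M (Z i) (\<lambda>\<omega>. row_times (x \<omega>) (A i)))"

abbreviation column_space :: "nat \<Rightarrow> 'q :: field mat \<Rightarrow> 'q vec set" where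
  "column_space l A \<equiv> vec_space.col_space l A"

definition vec_subspace :: "nat \<Rightarrow> 'q :: field vec set \<Rightarrow> bool" where
  "vec_subspace l S \<longleftrightarrow> VectorSpace.subspace class_ring S (module_vec TYPE('q) l)"

definition subspace_dim :: "nat \<Rightarrow> 'q :: field vec set \<Rightarrow> nat" where
  "subspace_dim l S =
     vectorspace.dim class_ring ((module_vec TYPE('q) l)\<lparr>carrier := S\<rparr>)"

end

theory Submission
  imports Defs
begin

text \<open>Let \<open>C\<^sub>i\<close> be the column space of \<open>M\<^sub>i\<close> and \<open>W\<^sub>j = C\<^sub>1 \<inter> \<dots> \<inter> C\<^sub>j\<close>. For subspaces \<open>S\<close> and \<open>T\<close>
  the observations \<open>x S\<close> and \<open>x T\<close> are conditionally independent given \<open>x (S \<inter> T)\<close>, and conditioning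
  on the discussion \<open>F\<close> in addition creates at most \<open>H(F)\<close> of mutual information. A key \<open>K\<close> that is
  recoverable both from \<open>(F, x W\<^sub>j)\<close> and from \<open>(F, x C\<^sub>j\<^sub>+\<^sub>1)\<close> therefore has conditional entropy at
  most \<open>H(F)\<close> given \<open>(F, x W\<^sub>j\<^sub>+\<^sub>1)\<close>, up to Fano terms. Intersecting one column space after the other
  gives \<open>H(K | F) \<le> H(x W\<^sub>m) + (m - 1) H(F)\<close> up to Fano terms, which at vanishing discussion rate
  leaves \<open>H(x W\<^sub>m)\<close> per source symbol. With a constant \<open>F\<close> the same inequality bounds every common
  random variable. Conversely \<open>x W\<^sub>m\<close> is a uniformly distributed function of every source, hence a key
  that needs no discussion.\<close>

text \<open>Linearity enters the converse through a single identity: a uniform \<open>x\<close>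
  turns entropies of \<open>x S\<close> into logarithms of cardinalities, and conditional
  independence becomes the dimension formula. For a general source the common part need not make the
  sources conditionally independent, and the argument breaks down there. Three obstacles shape the
  converse. A scheme shares only the law of the sources with the given space, so it carries no
  vector \<open>x\<close>; a substitute is reconstructed from the source symbols, and it agrees with
  \<open>x\<close> only on each of the column spaces. Private randomness may have infinite entropy,
  so it is replaced by the decoding function that it selects, of which there are finitely many; it
  drops out of the common part as soon as two users are intersected, since private parts are
  independent. Finally, Fano's inequality charges a fraction of log |K|, which is not assumed to be
  O(n), so the limit cannot be taken term by term.\<close>

no_notation inner (infix "\<bullet>" 70)

section \<open>Entropy inequalities\<close>

context information_space
begin

section \<open>Gibbs' inequality, submodularity and Fano's inequality\<close>

lemma expectation_simple:
  fixes \<phi> :: "'b \<Rightarrow> real"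
  assumes X: "simple_function M X"
  shows "expectation (\<lambda>w. \<phi> (X w)) = (\<Sum>x\<in>X ` space M. prob (X -` {x} \<inter> space M) * \<phi> x)"
proof -
  have fin: "finite (X ` space M)" and meas: "\<And>x. X -` {x} \<inter> space M \<in> events"
    using X simple_functionD(2)[OF X] by (auto simp: simple_function_def)
  have "expectation (\<lambda>w. \<phi> (X w))
      = expectation (\<lambda>w. \<Sum>x\<in>X ` space M. \<phi> x * indicator (X -` {x} \<inter> space M) w)"
  proof (rule Bochner_Integration.integral_cong[OF refl])
    fix w assume w: "w \<in> space M"
    have "(\<Sum>x\<in>X ` space M. \<phi> x * indicator (X -` {x} \<inter> space M) w)
        = (\<Sum>x\<in>X ` space M. if x = X w then \<phi> x else 0)"
      using w by (intro sum.cong) (auto simp: indicator_def)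
    then show "\<phi> (X w) = (\<Sum>x\<in>X ` space M. \<phi> x * indicator (X -` {x} \<inter> space M) w)"
      using w fin by simp
  qed
  also have "\<dots> = (\<Sum>x\<in>X ` space M. prob (X -` {x} \<inter> space M) * \<phi> x)"
    using meas by (subst Bochner_Integration.integral_sum)
      (auto simp: mult.commute emeasure_eq_measure intro!: sum.cong)
  finally show ?thesis .
qed

lemma integrable_simple:
  fixes \<phi> :: "'b \<Rightarrow> real"
  assumes X: "simple_function M X"
  shows "integrable M (\<lambda>w. \<phi> (X w))"
proof -
  have "simple_function M (\<lambda>w. \<phi> (X w))"
    using simple_function_compose1[OF X] .
  then show ?thesis
    by (intro integrable_simple_function) (auto simp: emeasure_eq_measure)
qed

lemma entropy_eq_sum:
  assumes "simple_function M X"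
  shows "\<H>(X) = - (\<Sum>x\<in>X ` space M. prob (X -` {x} \<inter> space M) * log b (prob (X -` {x} \<inter> space M)))"
  by (rule entropy_simple_distributed[OF simple_distributedI[OF assms measure_nonneg refl]])

lemma entropy_eq_expectation:
  assumes "simple_function M X"
  shows "\<H>(X) = - expectation (\<lambda>w. log b (prob (X -` {X w} \<inter> space M)))"
  unfolding entropy_eq_sum[OF assms] expectation_simple[OF assms, of "\<lambda>x. log b (prob (X -` {x} \<inter> space M))"] ..

text \<open>The bound ln t \<le> t - 1 at t = q / p, summed over the range. Submodularity and Fano's
  inequality are both instances, for weights on a product that may exceed the range of
  \<open>X\<close>; hence a total of at most 1, and positivity only where \<open>X\<close> has
  mass.\<close>

lemma Gibbs_inequality:
  assumes X: "simple_function M X"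
    and pos: "\<And>w. w \<in> space M \<Longrightarrow> prob (X -` {X w} \<inter> space M) > 0 \<Longrightarrow> q (X w) > 0"
    and nn: "\<And>w. w \<in> space M \<Longrightarrow> q (X w) \<ge> 0"
    and le1: "(\<Sum>x\<in>X ` space M. q x) \<le> (1::real)"
  shows "\<H>(X) \<le> - expectation (\<lambda>w. log b (q (X w)))"
proof -
  let ?p = "\<lambda>x. prob (X -` {x} \<inter> space M)"
  have b: "ln b > 0" using b_gt_1 by simp
  have "(\<Sum>x\<in>X ` space M. ?p x * (log b (q x) - log b (?p x)))
      \<le> (\<Sum>x\<in>X ` space M. (q x - ?p x) / ln b)"
  proof (rule sum_mono)
    fix x assume x: "x \<in> X ` space M"
    show "?p x * (log b (q x) - log b (?p x)) \<le> (q x - ?p x) / ln b"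
    proof (cases "?p x > 0")
      case True
      then have q: "q x > 0" using pos x by auto
      have "?p x * ln (q x / ?p x) \<le> ?p x * (q x / ?p x - 1)"
        using True q by (intro mult_left_mono ln_le_minus_one) auto
      also have "\<dots> = q x - ?p x" using True by (simp add: field_simps)
      finally have "?p x * (ln (q x) - ln (?p x)) \<le> q x - ?p x"
        using True q by (simp add: ln_div)
      then have "?p x * (ln (q x) - ln (?p x)) / ln b \<le> (q x - ?p x) / ln b"
        using b by (intro divide_right_mono) auto
      then show ?thesis by (simp add: log_def diff_divide_distrib right_diff_distrib)
    next
      case False
      then have "?p x = 0" by (simp add: zero_less_measure_iff)
      then show ?thesis using nn x b by auto
    qed
  qed
  also have "\<dots> = ((\<Sum>x\<in>X ` space M. q x) - expectation (\<lambda>w. 1)) / ln b"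
    using expectation_simple[OF X, of "\<lambda>_. 1"]
    by (simp add: sum_subtractf sum_divide_distrib[symmetric])
  also have "\<dots> \<le> 0" using le1 b by (simp add: divide_nonpos_pos prob_space)
  finally show ?thesis
    unfolding entropy_eq_sum[OF X] expectation_simple[OF X, of "\<lambda>x. log b (q x)"]
    by (simp add: right_diff_distrib sum_subtractf)
qed

lemma sum_joint_prob:
  assumes X: "simple_function M X" and Y: "simple_function M Y"
  shows "(\<Sum>x\<in>X ` space M. prob ((\<lambda>w. (X w, Y w)) -` {(x, y)} \<inter> space M)) = prob (Y -` {y} \<inter> space M)"
proof -
  have "prob (Y -` {y} \<inter> space M) = prob (\<Union>x\<in>X ` space M. (\<lambda>w. (X w, Y w)) -` {(x, y)} \<inter> space M)"
    by (intro arg_cong[where f=prob]) auto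
  also have "\<dots> = (\<Sum>x\<in>X ` space M. prob ((\<lambda>w. (X w, Y w)) -` {(x, y)} \<inter> space M))"
    using simple_functionD[OF simple_function_Pair[OF X Y]] simple_functionD(1)[OF X]
    by (intro finite_measure_finite_Union) (auto simp: disjoint_family_on_def)
  finally show ?thesis ..
qed

lemma prob_fiber_mono:
  assumes X: "simple_function M X" and w: "w \<in> space M"
    and sub: "\<And>v. v \<in> space M \<Longrightarrow> X v = X w \<Longrightarrow> Y v = Y w"
    and Y: "simple_function M Y"
  shows "prob (X -` {X w} \<inter> space M) \<le> prob (Y -` {Y w} \<inter> space M)"
  using simple_functionD(2)[OF Y, of "{Y w}"] sub by (intro finite_measure_mono) auto

text \<open>There are finitely many values, so those of probability zero can be discarded together;
  this licenses the laws of the logarithm under an expectation.\<close>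

lemma AE_prob_fiber:
  assumes X: "simple_function M X"
  shows "AE w in M. prob (X -` {X w} \<inter> space M) > 0"
proof -
  have "AE w in M. X w \<noteq> x \<or> prob (X -` {x} \<inter> space M) > 0" for x
  proof (cases "prob (X -` {x} \<inter> space M) > 0")
    case False
    then have "X -` {x} \<inter> space M \<in> null_sets M"
      using simple_functionD(2)[OF X] by (auto simp: null_sets_def emeasure_eq_measure zero_less_measure_iff)
    then show ?thesis by (rule AE_I') auto
  qed auto
  then have "AE w in M. \<forall>x\<in>X ` space M. X w \<noteq> x \<or> prob (X -` {x} \<inter> space M) > 0"
    using simple_functionD(1)[OF X] by (intro AE_finite_allI)
  with AE_space show ?thesis by eventually_elim auto
qed

text \<open>This is I(X ; Y | Z) \<ge> 0. The weight in Gibbs' inequality is p(x, z) p(y, z) / p(z),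
  the law under which the first two components are conditionally independent given the
  third.\<close>

lemma entropy_submodular:
  assumes X: "simple_function M X" and Y: "simple_function M Y" and Z: "simple_function M Z"
  shows "\<H>(\<lambda>w. (X w, Y w, Z w)) + \<H>(Z) \<le> \<H>(\<lambda>w. (X w, Z w)) + \<H>(\<lambda>w. (Y w, Z w))"
proof -
  let ?T = "\<lambda>w. (X w, Y w, Z w)" and ?XZ = "\<lambda>w. (X w, Z w)" and ?YZ = "\<lambda>w. (Y w, Z w)"
  define p1 where "p1 t = prob (?XZ -` {t} \<inter> space M)" for t
  define p2 where "p2 t = prob (?YZ -` {t} \<inter> space M)" for t
  define p3 where "p3 t = prob (Z -` {t} \<inter> space M)" for t
  have XZ: "simple_function M ?XZ" and YZ: "simple_function M ?YZ" and T: "simple_function M ?T"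
    using X Y Z by (auto intro!: simple_function_Pair)
  define q where "q = (\<lambda>(x, y, z). p1 (x, z) * p2 (y, z) / p3 z)"
  have nn: "p1 t \<ge> 0" "p2 s \<ge> 0" "p3 u \<ge> 0" for t s u
    by (auto simp: p1_def p2_def p3_def)
  have posall: "p1 (?XZ w) > 0 \<and> p2 (?YZ w) > 0 \<and> p3 (Z w) > 0"
    if "w \<in> space M" "prob (?T -` {?T w} \<inter> space M) > 0" for w
    using that(2) prob_fiber_mono[OF T that(1) _ XZ] prob_fiber_mono[OF T that(1) _ YZ]
      prob_fiber_mono[OF T that(1) _ Z]
    by (auto simp: p1_def p2_def p3_def)
  have fin: "finite (X ` space M)" "finite (Y ` space M)" "finite (Z ` space M)"
    using X Y Z by (auto dest: simple_functionD)
  have "(\<Sum>t\<in>?T ` space M. q t) \<le> (\<Sum>t\<in>X ` space M \<times> Y ` space M \<times> Z ` space M. q t)"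
    using fin nn by (intro sum_mono2) (auto simp: q_def)
  also have "\<dots> = (\<Sum>x\<in>X ` space M. \<Sum>y\<in>Y ` space M. \<Sum>z\<in>Z ` space M. q (x, y, z))"
    by (simp add: sum.cartesian_product)
  also have "\<dots> = (\<Sum>x\<in>X ` space M. \<Sum>z\<in>Z ` space M. \<Sum>y\<in>Y ` space M. q (x, y, z))"
    by (intro sum.cong refl sum.swap)
  also have "\<dots> = (\<Sum>z\<in>Z ` space M. \<Sum>x\<in>X ` space M. \<Sum>y\<in>Y ` space M. q (x, y, z))"
    by (rule sum.swap)
  also have "\<dots> = (\<Sum>z\<in>Z ` space M. p3 z)"
  proof (rule sum.cong[OF refl])
    fix z
    have "(\<Sum>x\<in>X ` space M. \<Sum>y\<in>Y ` space M. q (x, y, z))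
        = (\<Sum>x\<in>X ` space M. p1 (x, z)) * (\<Sum>y\<in>Y ` space M. p2 (y, z)) / p3 z"
      by (simp add: q_def sum_product sum_divide_distrib)
    \<comment> \<open>A value of probability zero causes no trouble, because division by zero yields
      zero.\<close>
    also have "\<dots> = p3 z"
      unfolding p1_def p2_def p3_def sum_joint_prob[OF X Z] sum_joint_prob[OF Y Z] by simp
    finally show "(\<Sum>x\<in>X ` space M. \<Sum>y\<in>Y ` space M. q (x, y, z)) = p3 z" .
  qed
  also have "\<dots> = 1"
    using expectation_simple[OF Z, of "\<lambda>_. 1"] by (simp add: p3_def prob_space)
  finally have le1: "(\<Sum>t\<in>?T ` space M. q t) \<le> 1" .
  have "\<H>(?T) \<le> - expectation (\<lambda>w. log b (q (?T w)))"
    using posall nn by (intro Gibbs_inequality T le1) (auto simp: q_def)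
  also have "expectation (\<lambda>w. log b (q (?T w)))
      = expectation (\<lambda>w. log b (p1 (?XZ w)) + log b (p2 (?YZ w)) - log b (p3 (Z w)))"
  proof (rule integral_cong_AE)
    have "AE w in M. prob (?T -` {?T w} \<inter> space M) > 0"
      by (rule AE_prob_fiber[OF T])
    then show "AE w in M. log b (q (?T w))
        = log b (p1 (?XZ w)) + log b (p2 (?YZ w)) - log b (p3 (Z w))"
    proof (rule AE_mp, intro AE_I2 impI)
      fix w assume w: "w \<in> space M" and "prob (?T -` {?T w} \<inter> space M) > 0"
      then have "p1 (?XZ w) > 0 \<and> p2 (?YZ w) > 0 \<and> p3 (Z w) > 0"
        by (rule posall)
      then show "log b (q (?T w)) = log b (p1 (?XZ w)) + log b (p2 (?YZ w)) - log b (p3 (Z w))"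
        by (simp add: q_def log_mult log_divide)
    qed
  next
    show "(\<lambda>w. log b (q (?T w))) \<in> borel_measurable M"
      by (rule borel_measurable_integrable[OF integrable_simple[OF T]])
  next
    show "(\<lambda>w. log b (p1 (?XZ w)) + log b (p2 (?YZ w)) - log b (p3 (Z w))) \<in> borel_measurable M"
      using integrable_simple[OF XZ, of "\<lambda>t. log b (p1 t)"] integrable_simple[OF YZ, of "\<lambda>t. log b (p2 t)"]
        integrable_simple[OF Z, of "\<lambda>t. log b (p3 t)"] by (intro borel_measurable_integrable) auto
  qed
  also have "\<dots> = - \<H>(?XZ) - \<H>(?YZ) + \<H>(Z)"
    using integrable_simple[OF XZ, of "\<lambda>t. log b (p1 t)"] integrable_simple[OF YZ, of "\<lambda>t. log b (p2 t)"]
      integrable_simple[OF Z, of "\<lambda>t. log b (p3 t)"]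
    unfolding entropy_eq_expectation[OF XZ] entropy_eq_expectation[OF YZ] entropy_eq_expectation[OF Z]
    by (simp add: p1_def p2_def p3_def)
  finally show ?thesis by simp
qed

text \<open>Gibbs' inequality for the conditional law of \<open>X\<close> given \<open>Y\<close> and the equal mixture of the point
  mass at \<open>Y\<close> and the uniform distribution on \<open>A\<close>; this costs \<open>log 2\<close> instead of the binary entropy.\<close>

lemma Fano_inequality:
  assumes X: "simple_function M X" and Y: "simple_function M Y"
    and A: "finite A" "X ` space M \<subseteq> A" "Y ` space M \<subseteq> A"
  shows "\<H>(\<lambda>w. (X w, Y w)) - \<H>(Y)
    \<le> log b 2 + prob {w \<in> space M. X w \<noteq> Y w} * log b (card A)"
proof -
  let ?XY = "\<lambda>w. (X w, Y w)"
  define N where "N = real (card A)"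
  obtain w0 where "w0 \<in> space M" using not_empty by blast
  then have "card A > 0" using A by (auto simp: card_gt_0_iff)
  then have N: "N \<ge> 1" by (simp add: N_def)
  define p where "p y = prob (Y -` {y} \<inter> space M)" for y
  define r where "r t = (if fst t = snd t then 1/2 else 0) + 1 / (2 * N)" for t :: "'b \<times> 'b"
  have r: "r t > 0" for t using N by (auto simp: r_def intro!: add_pos_pos)
  have XY: "simple_function M ?XY" using X Y by (rule simple_function_Pair)
  \<comment> \<open>On the diagonal the point mass alone gives 1/2; off it the uniform half gives 1
    / (2 N).\<close>
  have rle: "- log b (r t) \<le> log b 2 + (if fst t = snd t then 0 else log b N)" for t
  proof (cases "fst t = snd t")
    case True
    have "log b (1/2) \<le> log b (r t)"
      using True N b_gt_1 by (intro log_mono) (auto simp: r_def)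
    then show ?thesis using True by (simp add: log_divide)
  next
    case False
    then show ?thesis using N b_gt_1 by (simp add: r_def log_divide log_mult)
  qed
  have "(\<Sum>t\<in>?XY ` space M. p (snd t) * r t) \<le> (\<Sum>t\<in>A \<times> Y ` space M. p (snd t) * r t)"
    using A simple_functionD(1)[OF Y] less_imp_le[OF r]
    by (intro sum_mono2) (auto simp: p_def intro!: mult_nonneg_nonneg)
  also have "\<dots> = (\<Sum>x\<in>A. \<Sum>y\<in>Y ` space M. p y * r (x, y))"
    by (simp add: sum.cartesian_product split_def)
  also have "\<dots> = (\<Sum>y\<in>Y ` space M. \<Sum>x\<in>A. p y * r (x, y))"
    by (rule sum.swap)
  also have "\<dots> = (\<Sum>y\<in>Y ` space M. p y)"
  proof (rule sum.cong[OF refl])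
    fix y assume "y \<in> Y ` space M"
    then have "y \<in> A" using A by auto
    then have "(\<Sum>x\<in>A. r (x, y)) = 1"
      using A N by (auto simp: r_def sum.distrib N_def)
    then show "(\<Sum>x\<in>A. p y * r (x, y)) = p y"
      by (simp flip: sum_distrib_left)
  qed
  also have "\<dots> = 1"
    using expectation_simple[OF Y, of "\<lambda>_. 1"] by (simp add: p_def prob_space)
  finally have le1: "(\<Sum>t\<in>?XY ` space M. p (snd t) * r t) \<le> 1" .
  have pos: "p (Y w) > 0" if "w \<in> space M" "prob (?XY -` {?XY w} \<inter> space M) > 0" for w
    using that(2) prob_fiber_mono[OF XY that(1) _ Y] by (auto simp: p_def)
  have "\<H>(?XY) \<le> - expectation (\<lambda>w. log b (p (snd (?XY w)) * r (?XY w)))"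
    using r less_imp_le[OF r] pos le1
    by (intro Gibbs_inequality[OF XY, where q="\<lambda>t. p (snd t) * r t"])
      (auto simp: p_def intro!: mult_nonneg_nonneg mult_pos_pos)
  \<comment> \<open>Only pairs off the diagonal pay log N, so integration produces the error
    probability.\<close>
  also have "\<dots> \<le> - expectation (\<lambda>w. log b (p (Y w)) - log b 2 - log b N * indicator {w \<in> space M. X w \<noteq> Y w} w)"
  proof -
    have "expectation (\<lambda>w. log b (p (Y w)) - log b 2 - log b N * indicator {w \<in> space M. X w \<noteq> Y w} w)
      = expectation (\<lambda>w. (\<lambda>t. log b (p (snd t)) - log b 2 - (if fst t = snd t then 0 else log b N)) (?XY w))"
      by (intro Bochner_Integration.integral_cong) (auto simp: indicator_def)
    also have "\<dots> \<le> expectation (\<lambda>w. log b (p (snd (?XY w)) * r (?XY w)))"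
      unfolding expectation_simple[OF XY, of "\<lambda>t. log b (p (snd t)) - log b 2 - (if fst t = snd t then 0 else log b N)"]
        expectation_simple[OF XY, of "\<lambda>t. log b (p (snd t) * r t)"]
    proof (rule sum_mono)
      fix t assume t: "t \<in> ?XY ` space M"
      show "prob (?XY -` {t} \<inter> space M) * (log b (p (snd t)) - log b 2 - (if fst t = snd t then 0 else log b N))
        \<le> prob (?XY -` {t} \<inter> space M) * log b (p (snd t) * r t)"
      proof (cases "prob (?XY -` {t} \<inter> space M) > 0")
        case True
        then have "p (snd t) > 0" using pos t by auto
        then show ?thesis using rle[of t] r[of t] by (intro mult_left_mono) (auto simp: log_mult)
      qed (auto simp: zero_less_measure_iff)
    qed
    finally show ?thesis by simp
  qed
  also have "\<dots> = \<H>(Y) + log b 2 + log b N * prob {w \<in> space M. X w \<noteq> Y w}"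
  proof -
    have eq: "{w \<in> space M. X w \<noteq> Y w} = ?XY -` {t. fst t \<noteq> snd t} \<inter> space M" by auto
    have [measurable]: "{w \<in> space M. X w \<noteq> Y w} \<in> events"
      unfolding eq by (rule simple_functionD(2)[OF XY])
    define E where "E = {w \<in> space M. X w \<noteq> Y w}"
    have [simp]: "integrable M (indicator E :: 'a \<Rightarrow> real)"
      unfolding E_def by (auto simp: emeasure_eq_measure)
    have "expectation (indicator E) = prob E"
      unfolding E_def by (subst Bochner_Integration.integral_indicator) (auto intro: arg_cong[where f=prob])
    then show ?thesis
      using integrable_simple[OF Y, of "\<lambda>y. log b (p y)"]
      unfolding entropy_eq_expectation[OF Y] E_def[symmetric]
      by (simp add: p_def prob_space)
  qed
  finally show ?thesis by (simp add: N_def mult.commute)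
qed


section \<open>Almost sure equality, functional dependence and conditional entropy\<close>

lemma entropy_cong_AE:
  assumes X: "simple_function M X" and Y: "simple_function M Y" and ae: "AE w in M. X w = Y w"
  shows "\<H>(X) = \<H>(Y)"
proof -
  have eq: "prob (X -` {x} \<inter> space M) = prob (Y -` {x} \<inter> space M)" for x
    using ae simple_functionD(2)[OF X] simple_functionD(2)[OF Y] by (intro finite_measure_eq_AE) auto
  have "expectation (\<lambda>w. log b (prob (X -` {X w} \<inter> space M)))
      = expectation (\<lambda>w. log b (prob (Y -` {Y w} \<inter> space M)))"
  proof (rule integral_cong_AE)
    show "AE w in M. log b (prob (X -` {X w} \<inter> space M)) = log b (prob (Y -` {Y w} \<inter> space M))"
      using ae by eventually_elim (simp add: eq)
  qed (use integrable_simple[OF X, of "\<lambda>x. log b (prob (X -` {x} \<inter> space M))"]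
         integrable_simple[OF Y, of "\<lambda>x. log b (prob (Y -` {x} \<inter> space M))"] in auto)
  then show ?thesis
    unfolding entropy_eq_expectation[OF X] entropy_eq_expectation[OF Y] by simp
qed

lemma entropy_mono_AE:
  assumes X: "simple_function M X" and Y: "simple_function M Y" and ae: "AE w in M. X w = f (Y w)"
  shows "\<H>(X) \<le> \<H>(Y)"
proof -
  have fY: "simple_function M (f \<circ> Y)" using Y by (rule simple_function_compose)
  have "\<H>(X) = \<H>(f \<circ> Y)" using ae by (intro entropy_cong_AE X fY) auto
  also have "\<dots> \<le> \<H>(Y)" using Y by (rule entropy_data_processing)
  finally show ?thesis .
qed

lemma entropy_mono:
  assumes "simple_function M X" "simple_function M Y" "\<And>w. w \<in> space M \<Longrightarrow> X w = f (Y w)"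
  shows "\<H>(X) \<le> \<H>(Y)"
  using assms by (intro entropy_mono_AE[where f=f]) auto

lemma entropy_eq_AE:
  assumes "simple_function M X" "simple_function M Y"
    and "AE w in M. X w = f (Y w)" "AE w in M. Y w = g (X w)"
  shows "\<H>(X) = \<H>(Y)"
  using entropy_mono_AE[OF assms(1,2,3)] entropy_mono_AE[OF assms(2,1,4)] by simp

lemma conditional_entropy_eq_diff:
  assumes X: "simple_function M X" and Y: "simple_function M Y"
  shows "\<H>(X | Y) = \<H>(\<lambda>w. (X w, Y w)) - \<H>(Y)"
proof -
  have "\<H>(\<lambda>w. (X w, Y w)) = \<H>(\<lambda>w. (Y w, X w))"
    using X Y by (intro entropy_eq_AE[where f=prod.swap and g=prod.swap] simple_function_Pair) auto
  then show ?thesis using entropy_chain_rule[OF Y X] by simp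
qed

text \<open>Turns the vanishing conditional entropies of the definitions into almost sure functional
  dependence. H(X | Y) is the mean of log (q / p), where the joint probability p is at most the
  marginal q. Vanishing therefore forces p = q wherever p is positive, and then no second value of
  \<open>X\<close> with positive weight fits over the same value of \<open>Y\<close>.\<close>

lemma conditional_entropy_eq_0_iff:
  assumes X: "simple_function M X" and Y: "simple_function M Y"
  shows "\<H>(X | Y) = 0 \<longleftrightarrow> (\<exists>f. AE w in M. X w = f (Y w))"
proof
  assume "\<exists>f. AE w in M. X w = f (Y w)"
  then obtain f where f: "AE w in M. X w = f (Y w)" ..
  have "\<H>(\<lambda>w. (X w, Y w)) = \<H>(Y)"
    using f X Y by (intro entropy_eq_AE[where f="\<lambda>y. (f y, y)" and g=snd] simple_function_Pair) auto
  then show "\<H>(X | Y) = 0" by (simp add: conditional_entropy_eq_diff[OF X Y])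
next
  assume 0: "\<H>(X | Y) = 0"
  let ?XY = "\<lambda>w. (X w, Y w)"
  let ?p = "\<lambda>t. prob (?XY -` {t} \<inter> space M)" and ?q = "\<lambda>y. prob (Y -` {y} \<inter> space M)"
  note XY = simple_function_Pair[OF X Y]
  have pq: "?p (X w, Y w) \<le> ?q (Y w)" if "w \<in> space M" for w
    using prob_fiber_mono[OF XY that _ Y] by simp
  have "(\<Sum>t\<in>?XY ` space M. ?p t * (log b (?q (snd t)) - log b (?p t))) = 0"
  proof -
    have "\<H>(X | Y) = expectation (\<lambda>w. log b (?q (Y w))) - expectation (\<lambda>w. log b (?p (X w, Y w)))"
      unfolding conditional_entropy_eq_diff[OF X Y] entropy_eq_expectation[OF XY] entropy_eq_expectation[OF Y]
      by simp
    also have "\<dots> = expectation (\<lambda>w. log b (?q (Y w)) - log b (?p (X w, Y w)))"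
      using integrable_simple[OF Y, of "\<lambda>y. log b (?q y)"] integrable_simple[OF XY, of "\<lambda>y. log b (?p y)"]
      by simp
    also have "\<dots> = (\<Sum>t\<in>?XY ` space M. ?p t * (log b (?q (snd t)) - log b (?p t)))"
      using expectation_simple[OF XY, of "\<lambda>t. log b (?q (snd t)) - log b (?p t)"] by simp
    finally show ?thesis using 0 by simp
  qed
  moreover have "?p t * (log b (?q (snd t)) - log b (?p t)) \<ge> 0" if t: "t \<in> ?XY ` space M" for t
  proof (cases "?p t > 0")
    case True
    then have "log b (?p t) \<le> log b (?q (snd t))"
      using pq t b_gt_1 by (intro log_mono) auto
    then show ?thesis by simp
  qed (simp add: zero_less_measure_iff)
  ultimately have eq0: "?p t * (log b (?q (snd t)) - log b (?p t)) = 0" if "t \<in> ?XY ` space M" for t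
    using simple_functionD(1)[OF XY] that by (subst (asm) sum_nonneg_eq_0_iff) auto
  have eq: "?p (X w, Y w) = ?q (Y w)" if w: "w \<in> space M" "?p (X w, Y w) > 0" for w
  proof -
    have "log b (?q (Y w)) = log b (?p (X w, Y w))" using eq0[of "(X w, Y w)"] w by auto
    moreover have "?q (Y w) > 0" using w pq[of w] by simp
    ultimately show ?thesis using w b_gt_1 by (simp add: log_def)
  qed
  define f where "f y = (SOME x. ?p (x, y) > 0)" for y
  have star: "X w = f (Y w)" if w: "w \<in> space M" and pos: "?p (X w, Y w) > 0" for w
  proof (rule ccontr)
    assume ne: "X w \<noteq> f (Y w)"
    have fpos: "?p (f (Y w), Y w) > 0" unfolding f_def using pos by (rule someI)
    have "?q (Y w) \<ge> prob ((?XY -` {(X w, Y w)} \<inter> space M) \<union> (?XY -` {(f (Y w), Y w)} \<inter> space M))"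
      using simple_functionD(2)[OF Y, of "{Y w}"] by (intro finite_measure_mono) auto
    also have "prob ((?XY -` {(X w, Y w)} \<inter> space M) \<union> (?XY -` {(f (Y w), Y w)} \<inter> space M))
        = ?p (X w, Y w) + ?p (f (Y w), Y w)"
      using simple_functionD(2)[OF XY] ne by (intro finite_measure_Union) auto
    finally show False using eq[OF w pos] fpos by simp
  qed
  have "AE w in M. X w = f (Y w)"
    using AE_prob_fiber[OF XY] AE_space by eventually_elim (rule star)
  then show "\<exists>f. AE w in M. X w = f (Y w)" by blast
qed

section \<open>Constant, uniform and independent variables\<close>

lemma entropy_const: "\<H>(\<lambda>_. c) = 0"
proof -
  have "(\<lambda>_::'a. c) ` space M = {c}" using not_empty by auto
  moreover have "(\<lambda>_::'a. c) -` {c} \<inter> space M = space M" by auto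
  ultimately show ?thesis
    by (subst entropy_eq_sum) (auto simp: prob_space)
qed

text \<open>Submodularity with a constant third variable.\<close>

lemma entropy_subadditive:
  assumes X: "simple_function M X" and Y: "simple_function M Y"
  shows "\<H>(\<lambda>w. (X w, Y w)) \<le> \<H>(X) + \<H>(Y)"
proof -
  note sf = X Y simple_function_Pair simple_function_const
  have "\<H>(\<lambda>w. (X w, Y w)) \<le> \<H>(\<lambda>w. (X w, Y w, ()))"
    by (intro entropy_mono[where f="\<lambda>(x, y, _). (x, y)"] sf) auto
  moreover have "\<H>(\<lambda>w. (X w, ())) \<le> \<H>(X)" "\<H>(\<lambda>w. (Y w, ())) \<le> \<H>(Y)"
    by (intro entropy_mono[where f="\<lambda>x. (x, ())"] sf; simp)+
  ultimately show ?thesis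
    using entropy_submodular[OF X Y simple_function_const, of "()"] entropy_const[of "()"] by linarith
qed

lemma entropy_le_log_card:
  assumes X: "simple_function M X" and A: "finite A" "X ` space M \<subseteq> A"
  shows "\<H>(X) \<le> log b (card A)"
proof -
  have "\<H>(X) \<le> log b (card (X ` space M))"
    by (rule entropy_le_card[OF simple_distributedI[OF X measure_nonneg refl]])
  also have "\<dots> \<le> log b (card A)"
    using A not_empty b_gt_1 finite_subset[OF A(2,1)]
    by (intro log_mono) (auto simp: card_gt_0_iff intro: card_mono)
  finally show ?thesis .
qed

lemma entropy_uniform_simple:
  assumes X: "simple_function M X" and c: "c > 0"
    and p: "\<And>w. w \<in> space M \<Longrightarrow> prob (X -` {X w} \<inter> space M) = 1 / c"
  shows "\<H>(X) = log b c"
proof -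
  have "expectation (\<lambda>w. log b (prob (X -` {X w} \<inter> space M))) = expectation (\<lambda>w. - log b c)"
    using p c b_gt_1 by (intro Bochner_Integration.integral_cong) (auto simp: log_divide)
  then show ?thesis by (simp add: entropy_eq_expectation[OF X] prob_space)
qed

lemma entropy_indep:
  assumes X: "simple_function M X" and Y: "simple_function M Y"
    and p: "\<And>x y. prob ((\<lambda>w. (X w, Y w)) -` {(x, y)} \<inter> space M)
        = prob (X -` {x} \<inter> space M) * prob (Y -` {y} \<inter> space M)"
  shows "\<H>(\<lambda>w. (X w, Y w)) = \<H>(X) + \<H>(Y)"
proof -
  let ?p = "\<lambda>x. prob (X -` {x} \<inter> space M)" and ?q = "\<lambda>y. prob (Y -` {y} \<inter> space M)"
  note XY = simple_function_Pair[OF X Y]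
  note int = integrable_simple[OF X, of "\<lambda>x. log b (?p x)"] integrable_simple[OF Y, of "\<lambda>x. log b (?q x)"]
  have "expectation (\<lambda>w. log b (prob ((\<lambda>w. (X w, Y w)) -` {(X w, Y w)} \<inter> space M)))
     = expectation (\<lambda>w. log b (?p (X w)) + log b (?q (Y w)))"
  proof (rule integral_cong_AE)
    show "AE w in M. log b (prob ((\<lambda>w. (X w, Y w)) -` {(X w, Y w)} \<inter> space M))
        = log b (?p (X w)) + log b (?q (Y w))"
      using AE_prob_fiber[OF X] AE_prob_fiber[OF Y] by eventually_elim (simp add: p log_mult)
  qed (use int integrable_simple[OF XY, of "\<lambda>t. log b (prob ((\<lambda>w. (X w, Y w)) -` {t} \<inter> space M))"] in auto)
  then show ?thesis
    unfolding entropy_eq_expectation[OF XY] entropy_eq_expectation[OF X] entropy_eq_expectation[OF Y]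
    using int by simp
qed

text \<open>In terms of conditional mutual information: the hypothesis \<open>cond_indep\<close> says
  \<open>I(S ; T | G) = 0\<close>, and conditioning on \<open>F\<close> raises this to at most \<open>H(F)\<close>.\<close>

lemma entropy_common_part:
  assumes K: "simple_function M K" and F: "simple_function M F" and S: "simple_function M S"
    and T: "simple_function M T" and G: "simple_function M G"
    and GS: "AE w in M. G w = f (S w)" and GT: "AE w in M. G w = g (T w)"
    and cond_indep: "\<H>(S) + \<H>(T) \<le> \<H>(\<lambda>w. (S w, T w)) + \<H>(G)"
  shows "\<H>(K | \<lambda>w. (F w, G w)) \<le> \<H>(K | \<lambda>w. (F w, S w)) + \<H>(K | \<lambda>w. (F w, T w)) + \<H>(F)"
proof -
  note sf = K F S T G simple_function_Pair
  \<comment> \<open>I(S ; T | K, F, G) \<ge> 0; the step in which the two ways of recovering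
    \<open>K\<close> meet.\<close>
  have "\<H>(\<lambda>w. (S w, T w, K w, F w, G w)) + \<H>(\<lambda>w. (K w, F w, G w))
      \<le> \<H>(\<lambda>w. (S w, K w, F w, G w)) + \<H>(\<lambda>w. (T w, K w, F w, G w))"
    by (intro entropy_submodular sf)
  moreover have "\<H>(\<lambda>w. (S w, T w, F w)) \<le> \<H>(\<lambda>w. (S w, T w, K w, F w, G w))"
    by (intro entropy_mono[where f="\<lambda>(s, t, k, f, g). (s, t, f)"] sf) auto
  moreover have "\<H>(\<lambda>w. (S w, T w)) \<le> \<H>(\<lambda>w. (S w, T w, F w))"
    by (intro entropy_mono[where f="\<lambda>(s, t, f). (s, t)"] sf) auto
  moreover have "\<H>(\<lambda>w. (S w, K w, F w, G w)) \<le> \<H>(\<lambda>w. (K w, F w, S w))"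
    using GS by (intro entropy_mono_AE[where f="\<lambda>(k, a, s). (s, k, a, f s)"] sf) auto
  moreover have "\<H>(\<lambda>w. (T w, K w, F w, G w)) \<le> \<H>(\<lambda>w. (K w, F w, T w))"
    using GT by (intro entropy_mono_AE[where f="\<lambda>(k, a, s). (s, k, a, g s)"] sf) auto
  \<comment> \<open>\<open>S\<close> is compared with \<open>F\<close> given \<open>G\<close>, at no
    cost; only \<open>T\<close> is compared with \<open>F\<close> unconditionally, so H(F) is paid
    once.\<close>
  moreover have "\<H>(\<lambda>w. (F w, S w, G w)) + \<H>(G) \<le> \<H>(\<lambda>w. (F w, G w)) + \<H>(\<lambda>w. (S w, G w))"
    by (intro entropy_submodular sf)
  moreover have "\<H>(\<lambda>w. (F w, S w)) \<le> \<H>(\<lambda>w. (F w, S w, G w))"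
    by (intro entropy_mono[where f="\<lambda>(s, t, f). (s, t)"] sf) auto
  moreover have "\<H>(\<lambda>w. (S w, G w)) \<le> \<H>(S)"
    using GS by (intro entropy_mono_AE[where f="\<lambda>s. (s, f s)"] sf) auto
  moreover have "\<H>(\<lambda>w. (F w, T w)) \<le> \<H>(F) + \<H>(T)"
    by (intro entropy_subadditive sf)
  ultimately show ?thesis
    using cond_indep by (simp add: conditional_entropy_eq_diff sf)
qed

end

section \<open>Subspaces over a finite field\<close>

lemma finite_carrier_vec: "finite (carrier_vec l :: 'q :: finite vec set)"
proof -
  have "carrier_vec l \<subseteq> vec_of_list ` {xs :: 'q list. set xs \<subseteq> UNIV \<and> length xs = l}"
  proof
    fix v :: "'q vec" assume "v \<in> carrier_vec l"
    then show "v \<in> vec_of_list ` {xs. set xs \<subseteq> UNIV \<and> length xs = l}"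
      by (intro image_eqI[of _ _ "list_of_vec v"]) (auto simp: vec_list)
  qed
  then show ?thesis
    by (rule finite_subset) (rule finite_imageI, rule finite_lists_length_eq, rule finite)
qed

lemma vec_subspace_iff:
  fixes S :: "'q :: field vec set"
  shows "vec_subspace l S \<longleftrightarrow> S \<subseteq> carrier_vec l \<and> 0\<^sub>v l \<in> S \<and>
    (\<forall>v\<in>S. \<forall>w\<in>S. v + w \<in> S) \<and> (\<forall>c. \<forall>v\<in>S. c \<cdot>\<^sub>v v \<in> S)"
proof -
  interpret vec_space "TYPE('q)" l .
  show ?thesis
    unfolding vec_subspace_def VectorSpace.subspace_def submodule_def
    using vectorspace_axioms module_axioms by (auto simp: class_ring_simps)
qed

lemma vec_subspaceD:
  fixes S :: "'q :: field vec set"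
  assumes "vec_subspace l S"
  shows "S \<subseteq> carrier_vec l" "0\<^sub>v l \<in> S" "v \<in> S \<Longrightarrow> w \<in> S \<Longrightarrow> v + w \<in> S"
    "v \<in> S \<Longrightarrow> c \<cdot>\<^sub>v v \<in> S" "v \<in> S \<Longrightarrow> w \<in> S \<Longrightarrow> v - w \<in> S"
proof -
  show *: "S \<subseteq> carrier_vec l" "0\<^sub>v l \<in> S" "v \<in> S \<Longrightarrow> w \<in> S \<Longrightarrow> v + w \<in> S" "v \<in> S \<Longrightarrow> c \<cdot>\<^sub>v v \<in> S"
    for v w c using assms by (auto simp: vec_subspace_iff)
  assume vw: "v \<in> S" "w \<in> S"
  then have "v - w = v + (-1) \<cdot>\<^sub>v w" using *(1) by (intro eq_vecI) auto
  moreover have "v + (-1) \<cdot>\<^sub>v w \<in> S" using vw *(3,4) by blast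
  ultimately show "v - w \<in> S" by simp
qed

lemma vec_subspace_finite:
  fixes S :: "'q :: {field, finite} vec set"
  shows "vec_subspace l S \<Longrightarrow> finite S"
  by (rule finite_subset[OF _ finite_carrier_vec]) (rule vec_subspaceD)

lemma vec_subspace_carrier: "vec_subspace l (carrier_vec l)"
  by (auto simp: vec_subspace_iff)

lemma vec_subspace_Inter:
  assumes "I \<noteq> {}" "\<And>i. i \<in> I \<Longrightarrow> vec_subspace l (C i)"
  shows "vec_subspace l (\<Inter>i\<in>I. C i)"
proof -
  obtain i where i: "i \<in> I" using assms(1) by blast
  show ?thesis
    unfolding vec_subspace_iff
  proof (intro conjI ballI allI INT_I)
    show "(\<Inter>i\<in>I. C i) \<subseteq> carrier_vec l" using vec_subspaceD(1)[OF assms(2)[OF i]] i by auto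
  next
    fix i assume "i \<in> I"
    then show "0\<^sub>v l \<in> C i" using assms(2) by (blast intro: vec_subspaceD)
  next
    fix v w i assume "v \<in> (\<Inter>i\<in>I. C i)" "w \<in> (\<Inter>i\<in>I. C i)" "i \<in> I"
    then show "v + w \<in> C i" using vec_subspaceD(3)[OF assms(2)] by simp
  next
    fix c v i assume "v \<in> (\<Inter>i\<in>I. C i)" "i \<in> I"
    then show "c \<cdot>\<^sub>v v \<in> C i" using vec_subspaceD(4)[OF assms(2)] by simp
  qed
qed

text \<open>Rescaling \<open>v0\<close> to a vector \<open>v1\<close> of value 1 splits
  \<open>G\<close> into the kernel and the line through \<open>v1\<close>. Linearity is asked of
  \<open>f\<close> on \<open>G\<close> only, as a bare function, so the lemma serves either argument
  of the scalar product.\<close>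

lemma card_kernel:
  fixes f :: "'q :: {field, finite} vec \<Rightarrow> 'q"
  assumes G: "vec_subspace l G"
    and add: "\<And>v w. v \<in> G \<Longrightarrow> w \<in> G \<Longrightarrow> f (v + w) = f v + f w"
    and smult: "\<And>c v. v \<in> G \<Longrightarrow> f (c \<cdot>\<^sub>v v) = c * f v"
    and nz: "v0 \<in> G" "f v0 \<noteq> 0"
  shows "card {v \<in> G. f v = 0} * CARD('q) = card G"
proof -
  note D = vec_subspaceD[OF G]
  define v1 where "v1 = (1 / f v0) \<cdot>\<^sub>v v0"
  have v1: "v1 \<in> G" "f v1 = 1" using nz D(4) by (auto simp: v1_def smult)
  have dims: "dim_vec v = l" if "v \<in> G" for v using that D(1) by auto
  have "bij_betw (\<lambda>(v, c). v + c \<cdot>\<^sub>v v1) ({v \<in> G. f v = 0} \<times> UNIV) G"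
  proof (rule bij_betw_byWitness[where f'="\<lambda>v. (v + (- f v) \<cdot>\<^sub>v v1, f v)"])
    show "\<forall>a\<in>{v \<in> G. f v = 0} \<times> UNIV. (\<lambda>v. (v + (- f v) \<cdot>\<^sub>v v1, f v)) ((\<lambda>(v, c). v + c \<cdot>\<^sub>v v1) a) = a"
      using v1 D(3,4) by (auto simp: add smult dims intro!: eq_vecI)
    show "\<forall>v\<in>G. (\<lambda>(v, c). v + c \<cdot>\<^sub>v v1) (v + (- f v) \<cdot>\<^sub>v v1, f v) = v"
      using v1 D(3,4) by (auto simp: dims intro!: eq_vecI)
    show "(\<lambda>(v, c). v + c \<cdot>\<^sub>v v1) ` ({v \<in> G. f v = 0} \<times> UNIV) \<subseteq> G"
      using v1 D(3,4) by auto
    show "(\<lambda>v. (v + (- f v) \<cdot>\<^sub>v v1, f v)) ` G \<subseteq> {v \<in> G. f v = 0} \<times> UNIV"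
      using v1 D(3,4) by (auto simp: add smult)
  qed
  from bij_betw_same_card[OF this] show ?thesis by (simp add: card_cartesian_product)
qed

section \<open>Annihilators and their cardinality\<close>

definition annihilator :: "nat \<Rightarrow> 'q :: field vec set \<Rightarrow> 'q vec set" where
  "annihilator l S = {v \<in> carrier_vec l. \<forall>s\<in>S. s \<bullet> v = 0}"

text \<open>Double counting of the pairs \<open>(s, v)\<close> with \<open>s \<bullet> v = 0\<close>, as a nonzero functional vanishes on the
  fraction \<open>1 / q\<close> of any subspace.\<close>

lemma card_annihilator:
  fixes S :: "'q :: {field, finite} vec set"
  assumes S: "vec_subspace l S"
  shows "card S * card (annihilator l S) = card (carrier_vec l :: 'q vec set)"
proof -
  note D = vec_subspaceD[OF S]
  let ?C = "carrier_vec l :: 'q vec set" and ?P = "annihilator l S"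
  define q where "q = CARD('q)"
  \<comment> \<open>The bound q \<ge> 2 allows the factor q - 1 to be cancelled at the end.\<close>
  have "card {0, 1 :: 'q} \<le> q" unfolding q_def by (rule card_mono) auto
  then have q: "q \<ge> 2" by simp
  have fin: "finite S" "finite ?C" "?P \<subseteq> ?C"
    using S finite_carrier_vec vec_subspace_finite by (auto simp: annihilator_def)
  then have finP: "finite ?P" by (auto intro: finite_subset)
  have SC: "s \<in> ?C" if "s \<in> S" for s using that D(1) by auto
  \<comment> \<open>Fractions are avoided by multiplying every count by q. For nonzero
    \<open>s\<close>, the unit vector at a nonzero coordinate is not orthogonal to it.\<close>
  have row: "card {v \<in> ?C. s \<bullet> v = 0} * q = (if s = 0\<^sub>v l then card ?C * q else card ?C)" if s: "s \<in> S" for s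
  proof (cases "s = 0\<^sub>v l")
    case False
    then obtain i where i: "i < l" "s $ i \<noteq> 0" using SC[OF s] by (auto simp: vec_eq_iff)
    have "card {v \<in> ?C. s \<bullet> v = 0} * CARD('q) = card ?C"
      using SC[OF s] i
      by (intro card_kernel[OF vec_subspace_carrier, where ?v0.0="unit_vec l i"])
        (auto simp: scalar_prod_add_distrib[of _ l])
    then show ?thesis using False by (simp add: q_def)
  next
    case True
    then have "{v \<in> ?C. s \<bullet> v = 0} = ?C" by auto
    then show ?thesis using True by simp
  qed
  have col: "card {s \<in> S. s \<bullet> v = 0} * q = (if v \<in> ?P then card S * q else card S)" if v: "v \<in> ?C" for v
  proof (cases "v \<in> ?P")
    case False
    then obtain s where s: "s \<in> S" "s \<bullet> v \<noteq> 0" using v by (auto simp: annihilator_def)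
    have "card {s \<in> S. s \<bullet> v = 0} * CARD('q) = card S"
      using SC v s by (intro card_kernel[OF S, where ?v0.0=s]) (auto simp: add_scalar_prod_distrib[of _ l])
    then show ?thesis using False by (simp add: q_def)
  next
    case True
    then have "{s \<in> S. s \<bullet> v = 0} = S" by (auto simp: annihilator_def)
    then show ?thesis using True by simp
  qed
  have "(\<Sum>s\<in>S. card {v \<in> ?C. s \<bullet> v = 0}) = card (SIGMA s:S. {v \<in> ?C. s \<bullet> v = 0})"
    using fin by (subst card_SigmaI) auto
  also have "\<dots> = card (SIGMA v:?C. {s \<in> S. s \<bullet> v = 0})"
    by (rule bij_betw_same_card[of prod.swap]) (auto simp: bij_betw_def inj_on_def image_iff)
  also have "\<dots> = (\<Sum>v\<in>?C. card {s \<in> S. s \<bullet> v = 0})"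
    using fin by (subst card_SigmaI) auto
  finally have "(\<Sum>s\<in>S. card {v \<in> ?C. s \<bullet> v = 0} * q) = (\<Sum>v\<in>?C. card {s \<in> S. s \<bullet> v = 0} * q)"
    by (simp add: sum_distrib_right[symmetric])
  then have "(\<Sum>s\<in>S. if s = 0\<^sub>v l then card ?C * q else card ?C) = (\<Sum>v\<in>?C. if v \<in> ?P then card S * q else card S)"
    using row col by simp
  moreover have "(\<Sum>s\<in>S. if s = 0\<^sub>v l then card ?C * q else card ?C) = card ?C * q + (card S - 1) * card ?C"
    using fin D(2) by (subst sum.remove[of _ "0\<^sub>v l"]) (auto simp: sum.If_cases Int_def)
  moreover have "(\<Sum>v\<in>?C. if v \<in> ?P then card S * q else card S)
      = card ?P * (card S * q) + (card ?C - card ?P) * card S"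
    using fin finP by (subst sum.subset_diff[of ?P]) (auto simp: card_Diff_subset)
  ultimately have "card ?C * q + (card S - 1) * card ?C = card ?P * (card S * q) + (card ?C - card ?P) * card S"
    by simp
  moreover have "card S \<ge> 1" using fin D(2) by (metis One_nat_def Suc_leI card_gt_0_iff empty_iff)
  moreover have "card ?P \<le> card ?C" using fin by (intro card_mono)
  \<comment> \<open>Both sides contain truncated differences, so the equation is solved over the
    integers.\<close>
  ultimately have "int (card ?C) * int q + (int (card S) - 1) * int (card ?C)
      = int (card ?P) * (int (card S) * int q) + (int (card ?C) - int (card ?P)) * int (card S)"
    by (metis (mono_tags, lifting) of_nat_1 of_nat_add of_nat_diff of_nat_mult)
  then have "(int q - 1) * int (card ?C) = (int q - 1) * (int (card S) * int (card ?P))"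
    by (simp add: algebra_simps)
  then have "int (card ?C) = int (card S * card ?P)" using q by simp
  then show ?thesis by (metis of_nat_eq_iff)
qed

section \<open>Sums of subspaces\<close>

definition subspace_plus :: "'q :: field vec set \<Rightarrow> 'q vec set \<Rightarrow> 'q vec set" where
  "subspace_plus S T = (\<lambda>(s, t). s + t) ` (S \<times> T)"

lemma vec_subspace_plus:
  assumes S: "vec_subspace l S" and T: "vec_subspace l T"
  shows "vec_subspace l (subspace_plus S T)"
proof -
  note DS = vec_subspaceD[OF S] and DT = vec_subspaceD[OF T]
  have dims: "dim_vec v = l" if "v \<in> S \<union> T" for v using that DS(1) DT(1) by auto
  have I: "s + t \<in> subspace_plus S T" if "s \<in> S" "t \<in> T" for s t
    using that by (auto simp: subspace_plus_def)
  show ?thesis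
    unfolding vec_subspace_iff
  proof (intro conjI ballI allI)
    show "subspace_plus S T \<subseteq> carrier_vec l"
      using DS(1) DT(1) by (auto simp: subspace_plus_def intro!: add_carrier_vec)
    show "0\<^sub>v l \<in> subspace_plus S T" using I[OF DS(2) DT(2)] by simp
  next
    fix v w assume "v \<in> subspace_plus S T" "w \<in> subspace_plus S T"
    then obtain s t s' t' where vw: "s \<in> S" "t \<in> T" "s' \<in> S" "t' \<in> T" "v = s + t" "w = s' + t'"
      by (auto simp: subspace_plus_def)
    then have "v + w = (s + s') + (t + t')" using dims by (intro eq_vecI) simp_all
    then show "v + w \<in> subspace_plus S T" using vw DS(3) DT(3) I by simp
  next
    fix c v assume "v \<in> subspace_plus S T"
    then obtain s t where v: "s \<in> S" "t \<in> T" "v = s + t" by (auto simp: subspace_plus_def)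
    then have "c \<cdot>\<^sub>v v = c \<cdot>\<^sub>v s + c \<cdot>\<^sub>v t"
      using dims by (intro eq_vecI) (simp_all add: distrib_left)
    then show "c \<cdot>\<^sub>v v \<in> subspace_plus S T" using v DS(4) DT(4) I by simp
  qed
qed

lemma subspace_plus_mono:
  assumes S: "vec_subspace l S" and T: "vec_subspace l T"
  shows "S \<subseteq> subspace_plus S T" "T \<subseteq> subspace_plus S T"
proof -
  note DS = vec_subspaceD[OF S] and DT = vec_subspaceD[OF T]
  show "S \<subseteq> subspace_plus S T"
  proof
    fix s assume "s \<in> S"
    then show "s \<in> subspace_plus S T" unfolding subspace_plus_def
      using DS(1) DT(2) by (intro image_eqI[of _ _ "(s, 0\<^sub>v l)"]) auto
  qed
  show "T \<subseteq> subspace_plus S T"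
  proof
    fix t assume "t \<in> T"
    then show "t \<in> subspace_plus S T" unfolding subspace_plus_def
      using DS(2) DT(1) by (intro image_eqI[of _ _ "(0\<^sub>v l, t)"]) auto
  qed
qed

text \<open>The dimension formula in multiplicative form. Addition on S \<times> T has all fibres of
  size |S \<inter> T|: the one over a + c consists of the pairs (a + w, c - w) with w in the
  intersection.\<close>

lemma card_subspace_plus:
  fixes S T :: "'q :: {field, finite} vec set"
  assumes S: "vec_subspace l S" and T: "vec_subspace l T"
  shows "card (subspace_plus S T) * card (S \<inter> T) = card S * card T"
proof -
  note DS = vec_subspaceD[OF S] and DT = vec_subspaceD[OF T]
  have dims: "dim_vec v = l" if "v \<in> S \<union> T" for v using that DS(1) DT(1) by auto
  have fin: "finite S" "finite T" using S T vec_subspace_finite by auto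
  let ?f = "\<lambda>(s, t). s + t"
  have fib: "card {p \<in> S \<times> T. ?f p = u} = card (S \<inter> T)" if "u \<in> subspace_plus S T" for u
  proof -
    from that obtain a c where ac: "a \<in> S" "c \<in> T" "u = a + c" by (auto simp: subspace_plus_def)
    have u: "dim_vec u = l" using ac dims by auto
    have eqs: "s - a = c - t" if "s \<in> S" "t \<in> T" "s + t = u" for s t
    proof (rule eq_vecI)
      fix i assume "i < dim_vec (c - t)"
      then have i: "i < l" using dims that by auto
      have "(s + t) $ i = (a + c) $ i" using that ac by simp
      moreover have "(s + t) $ i = s $ i + t $ i" "(a + c) $ i = a $ i + c $ i"
        using that(1,2) ac(1,2) dims i by auto
      ultimately have "s $ i + t $ i = a $ i + c $ i" by metis
      then show "(s - a) $ i = (c - t) $ i" using that ac dims i by (auto simp: algebra_simps)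
    qed (use that ac dims in auto)
    have "bij_betw (\<lambda>w. (a + w, c - w)) (S \<inter> T) {p \<in> S \<times> T. ?f p = u}"
    proof (rule bij_betw_byWitness[where f'="\<lambda>(s, t). s - a"])
      show "\<forall>w\<in>S \<inter> T. (\<lambda>(s, t). s - a) (a + w, c - w) = w"
        using ac dims by (auto intro!: eq_vecI)
      show "\<forall>p\<in>{p \<in> S \<times> T. ?f p = u}. (\<lambda>w. (a + w, c - w)) ((\<lambda>(s, t). s - a) p) = p"
      proof -
        have "a + (s - a) = s \<and> c - (s - a) = t" if st: "s \<in> S" "t \<in> T" "s + t = u" for s t
        proof -
          have "a + (s - a) = s" using st(1) ac dims by (intro eq_vecI) simp_all
          moreover have "c - (c - t) = t" using st(2) ac dims by (intro eq_vecI) simp_all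
          ultimately show ?thesis using eqs[OF st] by simp
        qed
        then show ?thesis by auto
      qed
      show "(\<lambda>w. (a + w, c - w)) ` (S \<inter> T) \<subseteq> {p \<in> S \<times> T. ?f p = u}"
      proof -
        have "a + w + (c - w) = u" if w: "w \<in> S" "w \<in> T" for w
          using w ac dims by (intro eq_vecI) simp_all
        then show ?thesis using ac DS(3) DT(5) by auto
      qed
      show "(\<lambda>(s, t). s - a) ` {p \<in> S \<times> T. ?f p = u} \<subseteq> S \<inter> T"
      proof -
        have "s - a \<in> S \<and> s - a \<in> T" if st: "s \<in> S" "t \<in> T" "s + t = u" for s t
          using DS(5)[OF st(1) ac(1)] DT(5)[OF ac(2) st(2)] eqs[OF st] by simp
        then show ?thesis by auto
      qed
    qed
    then show ?thesis by (simp add: bij_betw_same_card)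
  qed
  have "card S * card T = card (S \<times> T)" by (simp add: card_cartesian_product)
  also have "\<dots> = (\<Sum>u\<in>subspace_plus S T. card {p \<in> S \<times> T. ?f p = u})"
    unfolding subspace_plus_def card_eq_sum using fin by (intro sum.image_gen) auto
  also have "\<dots> = card (subspace_plus S T) * card (S \<inter> T)" using fib by simp
  finally show ?thesis ..
qed

section \<open>Column spaces and dimensions\<close>

lemma column_space_eq_image:
  assumes "dim_row A = l"
  shows "column_space l A = (\<lambda>c. A *\<^sub>v c) ` carrier_vec (dim_col A)"
proof -
  have A: "A \<in> carrier_mat l (dim_col A)" using assms by auto
  show ?thesis
    unfolding vec_space.col_space_eq[OF A] assms using mult_mat_vec_carrier[OF A] by blast
qed

lemma column_space_subspace:
  assumes A: "dim_row A = l"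
  shows "vec_subspace l (column_space l A)"
proof -
  have A': "A \<in> carrier_mat l (dim_col A)" using assms by auto
  note mem = image_eqI[of _ "(\<lambda>c. A *\<^sub>v c)" _ "carrier_vec (dim_col A)"]
  show ?thesis
    unfolding vec_subspace_iff column_space_eq_image[OF A]
  proof (intro conjI ballI allI)
    show "(\<lambda>c. A *\<^sub>v c) ` carrier_vec (dim_col A) \<subseteq> carrier_vec l"
      using mult_mat_vec_carrier[OF A'] by blast
    show "0\<^sub>v l \<in> (\<lambda>c. A *\<^sub>v c) ` carrier_vec (dim_col A)"
      using A by (intro mem[of _ "0\<^sub>v (dim_col A)"] eq_vecI) simp_all
  next
    fix v w assume "v \<in> (\<lambda>c. A *\<^sub>v c) ` carrier_vec (dim_col A)" "w \<in> (\<lambda>c. A *\<^sub>v c) ` carrier_vec (dim_col A)"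
    then obtain c d where cd: "c \<in> carrier_vec (dim_col A)" "d \<in> carrier_vec (dim_col A)"
      "v = A *\<^sub>v c" "w = A *\<^sub>v d" by blast
    have "v + w = A *\<^sub>v (c + d)" using cd mult_add_distrib_mat_vec[OF A' cd(1,2)] by simp
    then show "v + w \<in> (\<lambda>c. A *\<^sub>v c) ` carrier_vec (dim_col A)"
      using cd by (intro mem[of _ "c + d"]) simp_all
  next
    fix a v assume "v \<in> (\<lambda>c. A *\<^sub>v c) ` carrier_vec (dim_col A)"
    then obtain c where c: "c \<in> carrier_vec (dim_col A)" "v = A *\<^sub>v c" by blast
    have "a \<cdot>\<^sub>v v = A *\<^sub>v (a \<cdot>\<^sub>v c)" using c mult_mat_vec[OF A' c(1)] by simp
    then show "a \<cdot>\<^sub>v v \<in> (\<lambda>c. A *\<^sub>v c) ` carrier_vec (dim_col A)"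
      using c by (intro mem[of _ "a \<cdot>\<^sub>v c"]) simp_all
  qed
qed

text \<open>Over a finite field all vectors of \<open>W\<close> can be taken as columns, so no basis
  is chosen.\<close>

lemma subspace_as_column_space:
  fixes W :: "'q :: {field, finite} vec set"
  assumes W: "vec_subspace l W"
  shows "\<exists>B. dim_row B = l \<and> column_space l B = W"
proof -
  interpret vec_space "TYPE('q)" l .
  obtain ws where ws: "set ws = W" using finite_list[OF vec_subspace_finite[OF W]] by blast
  have "set (cols (mat_of_cols l ws)) = W"
    using ws vec_subspaceD(1)[OF W] by (subst cols_mat_of_cols) auto
  then have "column_space l (mat_of_cols l ws) = span W"
    by (simp add: col_space_def)
  also have "span W = W"
  proof
    have "submodule class_ring W V"
      using W by (simp add: vec_subspace_def VectorSpace.subspace_def)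
    then show "span W \<subseteq> W" by (intro span_is_subset) auto
    show "W \<subseteq> span W" using vec_subspaceD(1)[OF W] by (intro in_own_span) auto
  qed
  finally show ?thesis by (intro exI[of _ "mat_of_cols l ws"]) auto
qed

text \<open>A basis of \<open>S\<close> stays independent in \<open>W\<close>, and with equal
  dimensions it is a basis of \<open>W\<close> as well. The two dimensions belong to different
  vector spaces, so independence and span are transferred through the ambient space. The second
  claim gives the uniqueness of the maximum common subspace.\<close>

lemma subspace_dim_mono:
  fixes S W :: "'q :: {field, finite} vec set"
  assumes S: "vec_subspace l S" and W: "vec_subspace l W" and SW: "S \<subseteq> W"
  shows "subspace_dim l S \<le> subspace_dim l W" "subspace_dim l S = subspace_dim l W \<Longrightarrow> S = W"
proof -
  interpret V: vec_space "TYPE('q)" l .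
  have sub: "VectorSpace.subspace class_ring S V.V" "VectorSpace.subspace class_ring W V.V"
    using S W by (auto simp: vec_subspace_def)
  have vs: "vectorspace class_ring (V.vs S)" "vectorspace class_ring (V.vs W)"
    using sub V.subspace_is_vs by auto
  interpret S: vectorspace class_ring "V.vs S" by (rule vs)
  interpret W: vectorspace class_ring "V.vs W" by (rule vs)
  have submods: "submodule class_ring S V.V" "submodule class_ring W V.V"
    using sub by (auto simp: VectorSpace.subspace_def)
  have "S.span S = S" using S.in_own_span[of S] S.span_is_subset2[of S] by simp
  then have "S.fin_dim" unfolding S.fin_dim_def using vec_subspace_finite[OF S] by auto
  moreover have "W.span W = W" using W.in_own_span[of W] W.span_is_subset2[of W] by simp
  then have "W.fin_dim" unfolding W.fin_dim_def using vec_subspace_finite[OF W] by auto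
  ultimately have fd: "S.fin_dim" "W.fin_dim" .
  obtain B where B: "finite B" "S.basis B" using S.finite_basis_exists fd by blast
  have BS: "B \<subseteq> S" "S.lin_indpt B" "S.span B = S" using B(2) by (auto simp: S.basis_def)
  have indep: "W.lin_indpt B"
    using V.span_li_not_depend(2)[OF BS(1) submods(1)] V.span_li_not_depend(2)[OF _ submods(2), of B] BS SW by auto
  have spans: "W.span B = S.span B"
    using V.span_li_not_depend(1)[OF BS(1) submods(1)] V.span_li_not_depend(1)[OF _ submods(2), of B] BS SW by auto
  have dimS: "S.dim = card B" using S.dim_basis B by blast
  show "subspace_dim l S \<le> subspace_dim l W"
    unfolding subspace_dim_def using W.li_le_dim(2)[OF fd(2) _ indep] BS SW dimS by auto
  assume "subspace_dim l S = subspace_dim l W"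
  then have "W.basis B"
    unfolding subspace_dim_def using W.dim_li_is_basis[OF fd(2) B(1) _ indep] BS SW dimS by auto
  then have "W.span B = W" unfolding W.basis_def by simp
  from trans[OF trans[OF BS(3)[symmetric] spans[symmetric]] this] show "S = W" .
qed

section \<open>A vector seen through the functionals of a subspace\<close>

lemma row_times_nth:
  assumes "dim_row A = l" "v \<in> carrier_vec l" "j < dim_col A"
  shows "row_times v A $ j = col A j \<bullet> v"
  using assms by (simp add: row_times_def)

lemma scalar_prod_mult_mat:
  fixes A :: "'q :: field mat"
  assumes A: "dim_row A = l" and v: "v \<in> carrier_vec l" and c: "c \<in> carrier_vec (dim_col A)"
  shows "(A *\<^sub>v c) \<bullet> v = c \<bullet> row_times v A"
proof -
  have A': "A \<in> carrier_mat l (dim_col A)" using assms by auto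
  have "c \<bullet> row_times v A = c \<bullet> (transpose_mat A *\<^sub>v v)" by (simp add: row_times_def)
  also have "\<dots> = (transpose_mat A *\<^sub>v v) \<bullet> c" using A v c by (intro comm_scalar_prod[of _ "dim_col A"] carrier_vecI) simp_all
  also have "\<dots> = v \<bullet> (A *\<^sub>v c)"
    using transpose_vec_mult_scalar[OF A' c v] by simp
  also have "\<dots> = (A *\<^sub>v c) \<bullet> v" using A v c by (intro comm_scalar_prod[of _ l] carrier_vecI) simp_all
  finally show ?thesis ..
qed

text \<open>The values at \<open>v\<close> of the linear functionals given by \<open>S\<close>, a coordinate-free form of \<open>v A\<close> for a
  matrix \<open>A\<close> with column space \<open>S\<close>.\<close>

definition functionals :: "'q :: field vec set \<Rightarrow> 'q vec \<Rightarrow> 'q vec \<Rightarrow> 'q" where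
  "functionals S v = (\<lambda>s. if s \<in> S then s \<bullet> v else 0)"

lemma functionals_restrict:
  assumes "T \<subseteq> S"
  shows "functionals T v = (\<lambda>s. if s \<in> T then functionals S v s else 0)"
  using assms by (auto simp: functionals_def fun_eq_iff)

lemma functionals_eq_iff:
  "functionals S v = functionals S w \<longleftrightarrow> (\<forall>s\<in>S. s \<bullet> v = s \<bullet> w)"
  by (auto simp: functionals_def fun_eq_iff)

text \<open>The columns lie in the column space, and conversely an element A c pairs with v as c
  pairs with v A. Up to relabelling, the observation of a user thus depends on the matrix only
  through its column space.\<close>

lemma functionals_column_space_eq_iff:
  fixes A :: "'q :: field mat"
  assumes A: "dim_row A = l" and v: "v \<in> carrier_vec l" and w: "w \<in> carrier_vec l"
  shows "functionals (column_space l A) v = functionals (column_space l A) w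
    \<longleftrightarrow> row_times v A = row_times w A"
proof
  assume eq: "functionals (column_space l A) v = functionals (column_space l A) w"
  have dims: "dim_vec (row_times u A) = dim_col A" for u by (simp add: row_times_def)
  show "row_times v A = row_times w A"
  proof (rule eq_vecI)
    fix j assume "j < dim_vec (row_times w A)"
    then have j: "j < dim_col A" by (simp add: dims)
    have "col A j = A *\<^sub>v unit_vec (dim_col A) j" using j A by (intro eq_vecI) auto
    then have "col A j \<in> column_space l A"
      unfolding column_space_eq_image[OF A] using j by (intro image_eqI) auto
    then show "row_times v A $ j = row_times w A $ j"
      using eq j A v w by (simp add: functionals_eq_iff row_times_nth)
  qed (simp add: dims)
next
  assume eq: "row_times v A = row_times w A"
  show "functionals (column_space l A) v = functionals (column_space l A) w"
    unfolding functionals_eq_iff column_space_eq_image[OF A]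
    using scalar_prod_mult_mat[OF A v] scalar_prod_mult_mat[OF A w] eq by auto
qed

text \<open>Seeing a vector through \<open>S\<close> and through \<open>T\<close> is seeing it
  through their sum; joint entropies thereby reduce to those of a single subspace.\<close>

lemma functionals_plus_eq_iff:
  assumes S: "vec_subspace l S" and T: "vec_subspace l T" and v: "v \<in> carrier_vec l" and w: "w \<in> carrier_vec l"
  shows "functionals (subspace_plus S T) v = functionals (subspace_plus S T) w
    \<longleftrightarrow> functionals S v = functionals S w \<and> functionals T v = functionals T w"
proof -
  have "(s + t) \<bullet> u = s \<bullet> u + t \<bullet> u" if "s \<in> S" "t \<in> T" "u \<in> carrier_vec l" for s t u
    using that vec_subspaceD(1)[OF S] vec_subspaceD(1)[OF T] by (intro add_scalar_prod_distrib[of _ l]) auto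
  then show ?thesis
    using subspace_plus_mono[OF S T] v w unfolding functionals_eq_iff by (auto simp: subspace_plus_def)
qed

text \<open>The fibres are cosets of the annihilator. Their equal sizes make the image of a uniform
  vector uniform.\<close>

lemma card_functionals_fiber:
  fixes S :: "'q :: {field, finite} vec set"
  assumes S: "vec_subspace l S" and w: "w \<in> carrier_vec l"
  shows "card {v \<in> carrier_vec l. functionals S v = functionals S w} = card (annihilator l S)"
proof (rule bij_betw_same_card)
  let ?C = "carrier_vec l :: 'q vec set"
  have SC: "s \<in> ?C" if "s \<in> S" for s using vec_subspaceD(1)[OF S] that by auto
  show "bij_betw (\<lambda>v. v - w) {v \<in> ?C. functionals S v = functionals S w} (annihilator l S)"
  proof (rule bij_betw_byWitness[where f'="\<lambda>u. u + w"])
    show "\<forall>v\<in>{v \<in> ?C. functionals S v = functionals S w}. v - w + w = v" using w by (auto intro!: eq_vecI)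
    show "\<forall>u\<in>annihilator l S. u + w - w = u" using w by (auto intro!: eq_vecI simp: annihilator_def)
    show "(\<lambda>v. v - w) ` {v \<in> ?C. functionals S v = functionals S w} \<subseteq> annihilator l S"
      using w SC by (auto simp: annihilator_def functionals_eq_iff scalar_prod_minus_distrib[of _ l])
    show "(\<lambda>u. u + w) ` annihilator l S \<subseteq> {v \<in> ?C. functionals S v = functionals S w}"
      using w SC by (auto simp: annihilator_def functionals_eq_iff scalar_prod_add_distrib[of _ l])
  qed
qed

text \<open>Counts \<open>carrier_vec l\<close> fibrewise and compares with
  \<open>card_annihilator\<close>; needed for the size of the key alphabet.\<close>

lemma card_functionals_image:
  fixes S :: "'q :: {field, finite} vec set"
  assumes S: "vec_subspace l S"
  shows "card (functionals S ` carrier_vec l) = card S"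
proof -
  let ?C = "carrier_vec l :: 'q vec set"
  have "card S * card (annihilator l S) = card ?C" by (rule card_annihilator[OF S])
  also have "\<dots> = (\<Sum>g\<in>functionals S ` ?C. card {v \<in> ?C. functionals S v = g})"
    unfolding card_eq_sum using finite_carrier_vec by (rule sum.image_gen)
  also have "\<dots> = (\<Sum>g\<in>functionals S ` ?C. card (annihilator l S))"
  proof (rule sum.cong[OF refl])
    fix g assume "g \<in> functionals S ` ?C"
    then obtain w where w: "w \<in> ?C" "g = functionals S w" by blast
    show "card {v \<in> ?C. functionals S v = g} = card (annihilator l S)"
      unfolding w(2) by (rule card_functionals_fiber[OF S w(1)])
  qed
  also have "\<dots> = card (functionals S ` ?C) * card (annihilator l S)"
    by (simp only: sum_constant of_nat_id)
  finally have eq: "card S * card (annihilator l S) = card (functionals S ` ?C) * card (annihilator l S)" .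
  have "0\<^sub>v l \<in> annihilator l S" using vec_subspaceD(1)[OF S] by (auto simp: annihilator_def)
  moreover have "finite (annihilator l S)"
    by (rule finite_subset[OF _ finite_carrier_vec[of l]]) (auto simp: annihilator_def)
  ultimately have "card (annihilator l S) \<noteq> 0" by (metis card_eq_0_iff empty_iff)
  from iffD1[OF mult_right_cancel[OF this] eq] show ?thesis by (rule sym)
qed

section \<open>Uniform vectors and common parts\<close>

context information_space
begin

text \<open>Monotonicity without naming the function that yields \<open>X\<close> from
  \<open>Y\<close>.\<close>

lemma entropy_mono_kernel:
  assumes X: "simple_function M X" and Y: "simple_function M Y"
    and ker: "\<And>v w. v \<in> space M \<Longrightarrow> w \<in> space M \<Longrightarrow> Y v = Y w \<Longrightarrow> X v = X w"
  shows "\<H>(X) \<le> \<H>(Y)"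
proof (rule entropy_mono[OF X Y])
  fix w assume w: "w \<in> space M"
  let ?v = "SOME v. v \<in> space M \<and> Y v = Y w"
  have "?v \<in> space M \<and> Y ?v = Y w" using w by (intro someI_ex[of "\<lambda>v. v \<in> space M \<and> Y v = Y w"]) auto
  then show "X w = X (SOME v. v \<in> space M \<and> Y v = Y w)" using ker[OF _ w] by simp
qed

text \<open>The converse in abstract form: \<open>T i\<close> is what user i sees,
  \<open>G j\<close> a common part of the first j users, \<delta> the Fano term. The base case is
  free of H(F), and each further user costs one application of \<open>entropy_common_part\<close>.
  It is used with a constant \<open>F\<close> for common random variables, and with blocks and
  private parts for schemes.\<close>

lemma conditional_entropy_common_chain:
  assumes K: "simple_function M K" and F: "simple_function M F"
    and T: "\<And>i. i \<in> {1..m} \<Longrightarrow> simple_function M (T i)"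
    and G: "\<And>j. j \<in> {1..m} \<Longrightarrow> simple_function M (G j)"
    and G1: "G 1 = T 1"
    and GG: "\<And>j. 1 \<le> j \<Longrightarrow> j < m \<Longrightarrow> \<exists>f. AE w in M. G (Suc j) w = f (G j w)"
    and GT: "\<And>j. 1 \<le> j \<Longrightarrow> j < m \<Longrightarrow> \<exists>f. AE w in M. G (Suc j) w = f (T (Suc j) w)"
    and dm: "\<And>j. 1 \<le> j \<Longrightarrow> j < m \<Longrightarrow>
      \<H>(G j) + \<H>(T (Suc j)) \<le> \<H>(\<lambda>w. (G j w, T (Suc j) w)) + \<H>(G (Suc j))"
    and \<delta>: "\<And>i. i \<in> {1..m} \<Longrightarrow> \<H>(K | \<lambda>w. (F w, T i w)) \<le> \<delta>"
    and m: "1 \<le> m"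
  shows "\<H>(K | F) \<le> real m * \<delta> + real (m - 1) * \<H>(F) + \<H>(G m)"
proof -
  have chain: "\<H>(K | \<lambda>w. (F w, G j w)) \<le> real j * \<delta> + real (j - 1) * \<H>(F)" if "1 \<le> j" "j \<le> m" for j
    using that
  proof (induction j rule: dec_induct)
    case base
    then show ?case using \<delta>[of 1] G1 m by simp
  next
    case (step j)
    obtain f g where "AE w in M. G (Suc j) w = f (G j w)" "AE w in M. G (Suc j) w = g (T (Suc j) w)"
      using GG[of j] GT[of j] step by auto
    then have "\<H>(K | \<lambda>w. (F w, G (Suc j) w))
        \<le> \<H>(K | \<lambda>w. (F w, G j w)) + \<H>(K | \<lambda>w. (F w, T (Suc j) w)) + \<H>(F)"
      using step by (intro entropy_common_part[where f=f and g=g] K F T G dm) auto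
    also have "\<dots> \<le> real j * \<delta> + real (j - 1) * \<H>(F) + \<delta> + \<H>(F)"
      using step \<delta>[of "Suc j"] by (intro add_mono) auto
    also have "\<dots> = real (Suc j) * \<delta> + real (Suc j - 1) * \<H>(F)"
      using step by (simp add: algebra_simps of_nat_diff)
    finally show ?case .
  qed
  have Gm: "simple_function M (G m)" using m by (intro G) auto
  note sf = K F Gm simple_function_Pair
  have "\<H>(\<lambda>w. (K w, F w)) \<le> \<H>(\<lambda>w. (K w, F w, G m w))"
    by (intro entropy_mono[where f="\<lambda>(k, f, g). (k, f)"] sf) auto
  moreover have "\<H>(\<lambda>w. (F w, G m w)) \<le> \<H>(F) + \<H>(G m)"
    by (intro entropy_subadditive sf)
  ultimately have "\<H>(K | F) \<le> \<H>(K | \<lambda>w. (F w, G m w)) + \<H>(G m)"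
    by (simp add: conditional_entropy_eq_diff sf)
  with chain[OF m order_refl] show ?thesis by simp
qed

lemma simple_function_uniform:
  fixes x :: "'a \<Rightarrow> 'q :: {field, finite} vec"
  assumes x: "x \<in> measurable M (count_space (carrier_vec l))"
  shows "simple_function M (\<lambda>w. f (x w))"
proof -
  have x': "x w \<in> carrier_vec l" if "w \<in> space M" for w
    using measurable_space[OF x that] by simp
  have "simple_function M x"
    unfolding simple_function_def
  proof (intro conjI ballI)
    show "finite (x ` space M)" using x' by (intro finite_subset[OF _ finite_carrier_vec[of l]]) auto
    fix v assume "v \<in> x ` space M"
    then show "x -` {v} \<inter> space M \<in> events" using x' by (intro measurable_sets[OF x]) auto
  qed
  then show ?thesis by (rule simple_function_compose1)
qed

lemma entropy_functionals:
  fixes x :: "'a \<Rightarrow> 'q :: {field, finite} vec"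
  assumes x: "x \<in> measurable M (count_space (carrier_vec l))"
    and unif: "distr M (count_space (carrier_vec l)) x = uniform_count_measure (carrier_vec l)"
    and S: "vec_subspace l S"
  shows "\<H>(\<lambda>w. functionals S (x w)) = log b (card S)"
proof (rule entropy_uniform_simple)
  let ?C = "carrier_vec l :: 'q vec set"
  have cards: "card S * card (annihilator l S) = card ?C" by (rule card_annihilator[OF S])
  have "0\<^sub>v l \<in> ?C" by simp
  then have C: "card ?C > 0" using finite_carrier_vec by (metis card_gt_0_iff empty_iff)
  then show "real (card S) > 0" using cards by (metis gr0I mult_is_0 of_nat_0_less_iff)
  fix w assume "w \<in> space M"
  then have xw: "x w \<in> ?C" using measurable_space[OF x] by simp
  let ?E = "{v \<in> ?C. functionals S v = functionals S (x w)}"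
  have cE: "card ?E = card (annihilator l S)" by (rule card_functionals_fiber[OF S xw])
  have "prob ((\<lambda>w. functionals S (x w)) -` {functionals S (x w)} \<inter> space M) = prob (x -` ?E \<inter> space M)"
    using measurable_space[OF x] by (intro arg_cong[where f=prob]) auto
  also have "\<dots> = measure (distr M (count_space ?C) x) ?E"
    using x by (subst measure_distr) auto
  also have "\<dots> = card ?E / card ?C"
    unfolding unif using finite_carrier_vec by (subst measure_uniform_count_measure) auto
  also have "\<dots> = 1 / card S"
    using C unfolding cE cards[symmetric] by (simp add: field_simps)
  finally show "prob ((\<lambda>w. functionals S (x w)) -` {functionals S (x w)} \<inter> space M) = 1 / card S" .
qed (rule simple_function_uniform[OF x])

text \<open>The dimension formula under the logarithm; in terms of information, I(x S ; x T | x (S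
  \<inter> T)) = 0.\<close>

lemma entropy_functionals_pair:
  fixes x :: "'a \<Rightarrow> 'q :: {field, finite} vec"
  assumes x: "x \<in> measurable M (count_space (carrier_vec l))"
    and unif: "distr M (count_space (carrier_vec l)) x = uniform_count_measure (carrier_vec l)"
    and S: "vec_subspace l S" and T: "vec_subspace l T"
  shows "\<H>(\<lambda>w. (functionals S (x w), functionals T (x w))) + log b (card (S \<inter> T))
    = log b (card S) + log b (card T)"
proof -
  have xC: "x w \<in> carrier_vec l" if "w \<in> space M" for w using measurable_space[OF x that] by simp
  have pos: "card U > 0" if "vec_subspace l U" for U :: "'q vec set"
    using vec_subspaceD(2)[OF that] vec_subspace_finite[OF that] by (auto simp: card_gt_0_iff)
  note plus = vec_subspace_plus[OF S T]
  have "\<H>(\<lambda>w. (functionals S (x w), functionals T (x w))) = \<H>(\<lambda>w. functionals (subspace_plus S T) (x w))"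
    using functionals_plus_eq_iff[OF S T xC xC] simple_function_uniform[OF x]
    by (intro antisym entropy_mono_kernel simple_function_Pair) auto
  also have "\<dots> = log b (card (subspace_plus S T))"
    by (rule entropy_functionals[OF x unif plus])
  finally have "\<H>(\<lambda>w. (functionals S (x w), functionals T (x w))) = log b (card (subspace_plus S T))" .
  moreover have inter: "vec_subspace l (S \<inter> T)"
    using vec_subspace_Inter[of "{S, T}" l "\<lambda>U. U"] S T by auto
  have "log b (card (subspace_plus S T)) + log b (card (S \<inter> T)) = log b (real (card (subspace_plus S T) * card (S \<inter> T)))"
    using pos[OF plus] pos[OF inter] by (simp add: log_mult)
  moreover have "log b (real (card S * card T)) = log b (card S) + log b (card T)"
    using pos[OF S] pos[OF T] by (simp add: log_mult)
  ultimately show ?thesis unfolding card_subspace_plus[OF S T] by simp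
qed


section \<open>Conditioning, independent blocks and transfer of laws\<close>

lemma conditional_entropy_antimono:
  assumes K: "simple_function M K" and Y: "simple_function M Y" and X: "simple_function M X"
    and f: "\<And>w. w \<in> space M \<Longrightarrow> X w = f (Y w)"
  shows "\<H>(K | Y) \<le> \<H>(K | X)"
proof -
  note sf = K Y X simple_function_Pair
  have "\<H>(\<lambda>w. (K w, Y w, X w)) + \<H>(X) \<le> \<H>(\<lambda>w. (K w, X w)) + \<H>(\<lambda>w. (Y w, X w))"
    by (intro entropy_submodular sf)
  moreover have "\<H>(\<lambda>w. (K w, Y w)) \<le> \<H>(\<lambda>w. (K w, Y w, X w))"
    by (intro entropy_mono[where f="\<lambda>(k, y, x). (k, y)"] sf) auto
  moreover have "\<H>(\<lambda>w. (Y w, X w)) \<le> \<H>(Y)"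
    using f by (intro entropy_mono[where f="\<lambda>y. (y, f y)"] sf) auto
  ultimately show ?thesis by (simp add: conditional_entropy_eq_diff sf)
qed

lemma prob_indep_prefix:
  fixes n k :: nat
  assumes ind: "indep_vars (\<lambda>_. count_space UNIV) X {..<n}" and k: "k \<le> n"
  shows "prob {w \<in> space M. \<forall>t<k. X t w = y t} = (\<Prod>t<k. prob (X t -` {y t} \<inter> space M))"
proof (cases "k = 0")
  case False
  have "{w \<in> space M. \<forall>t<k. X t w = y t} = (\<Inter>t\<in>{..<k}. X t -` {y t} \<inter> space M)"
    using False by auto
  moreover have "prob (\<Inter>t\<in>{..<k}. X t -` {y t} \<inter> space M) = (\<Prod>t<k. prob (X t -` {y t} \<inter> space M))"
    using False k by (intro indep_varsD[OF ind]) auto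
  ultimately show ?thesis by simp
qed (simp add: prob_space)

lemma entropy_indep_list:
  fixes X :: "nat \<Rightarrow> 'a \<Rightarrow> 'c"
  assumes ind: "indep_vars (\<lambda>_. count_space UNIV) X {..<n}"
    and X: "\<And>t. t < n \<Longrightarrow> simple_function M (X t)"
  shows "simple_function M (\<lambda>w. map (\<lambda>t. X t w) [0..<n])"
    and "\<H>(\<lambda>w. map (\<lambda>t. X t w) [0..<n]) = (\<Sum>t<n. \<H>(X t))"
proof -
  let ?L = "\<lambda>k w. map (\<lambda>t. X t w) [0..<k]"
  have *: "simple_function M (?L k) \<and> \<H>(?L k) = (\<Sum>t<k. \<H>(X t))" if "k \<le> n" for k
    using that
  proof (induction k)
    case 0
    then show ?case using entropy_const[of "[]"] by simp
  next
    case (Suc k)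
    then have L: "simple_function M (?L k)" and Xk: "simple_function M (X k)" using X by auto
    note P = simple_function_Pair[OF L Xk]
    have sf: "simple_function M (?L (Suc k))"
      using simple_function_compose1[OF P, of "\<lambda>(xs, x). xs @ [x]"] by simp
    have "\<H>(?L (Suc k)) = \<H>(\<lambda>w. (?L k w, X k w))"
      using sf P by (intro antisym entropy_mono_kernel) auto
    also have "\<dots> = \<H>(?L k) + \<H>(X k)"
    proof (rule entropy_indep[OF L Xk])
      fix ys y
      show "prob ((\<lambda>w. (?L k w, X k w)) -` {(ys, y)} \<inter> space M)
          = prob (?L k -` {ys} \<inter> space M) * prob (X k -` {y} \<inter> space M)"
      proof (cases "length ys = k")
        case True
        \<comment> \<open>The word and the next symbol are merged into one pattern, so that both
          events are prefix events of the independent family.\<close>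
        define z where "z t = (if t < k then ys ! t else y)" for t
        have Lys: "?L k w = ys \<longleftrightarrow> (\<forall>t<k. X t w = z t)" for w
          unfolding list_eq_iff_nth_eq using True by (simp add: z_def)
        have "(\<forall>t<Suc k. X t w = z t) \<longleftrightarrow> ?L k w = ys \<and> X k w = y" for w
          unfolding Lys less_Suc_eq by (auto simp: z_def)
        then have "(\<lambda>w. (?L k w, X k w)) -` {(ys, y)} \<inter> space M = {w \<in> space M. \<forall>t<Suc k. X t w = z t}"
          by auto
        moreover have "?L k -` {ys} \<inter> space M = {w \<in> space M. \<forall>t<k. X t w = z t}"
          using Lys by auto
        moreover have "z k = y" by (simp add: z_def)
        ultimately show ?thesis
          using prob_indep_prefix[OF ind, of "Suc k" z] prob_indep_prefix[OF ind, of k z] Suc.prems by simp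
      next
        case False
        then have "(\<lambda>w. (?L k w, X k w)) -` {(ys, y)} \<inter> space M = {}" "?L k -` {ys} \<inter> space M = {}"
          by auto
        then show ?thesis by simp
      qed
    qed
    finally show ?case using Suc sf by simp
  qed
  from *[OF order_refl] show "simple_function M (?L n)" "\<H>(?L n) = (\<Sum>t<n. \<H>(X t))" by auto
qed

end

text \<open>A scheme lives on its own sample space and shares only the law of the sources with the
  given one; this carries single-letter entropies over.\<close>

lemma entropy_eq_of_distr_eq:
  assumes M: "information_space M b" and N: "information_space N b"
    and X: "X \<in> measurable M (count_space UNIV)" and Y: "Y \<in> measurable N (count_space UNIV)"
    and eq: "distr M (count_space UNIV) X = distr N (count_space UNIV) Y"
    and fX: "simple_function M (\<lambda>w. f (X w))" and fY: "simple_function N (\<lambda>w. f (Y w))"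
  shows "rv_entropy b M (\<lambda>w. f (X w)) = rv_entropy b N (\<lambda>w. f (Y w))"
proof -
  interpret M: information_space M b by (rule M)
  interpret N: information_space N b by (rule N)
  let ?p = "\<lambda>v. M.prob ((\<lambda>w. f (X w)) -` {v} \<inter> space M)" and ?q = "\<lambda>v. N.prob ((\<lambda>w. f (Y w)) -` {v} \<inter> space N)"
  let ?A = "(\<lambda>w. f (X w)) ` space M" and ?B = "(\<lambda>w. f (Y w)) ` space N"
  have pq: "?p v = ?q v" for v
  proof -
    have "?p v = measure (distr M (count_space UNIV) X) (f -` {v})"
      using X by (subst measure_distr) (auto intro: arg_cong[where f=M.prob])
    also have "\<dots> = ?q v"
      unfolding eq using Y by (subst measure_distr) (auto intro: arg_cong[where f=N.prob])
    finally show ?thesis .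
  qed
  have fin: "finite ?A" "finite ?B" using fX fY by (auto dest: simple_functionD)
  have p0: "?p v = 0" if "v \<notin> ?A" for v
  proof -
    have "(\<lambda>w. f (X w)) -` {v} \<inter> space M = {}" using that by auto
    then show ?thesis by simp
  qed
  have q0: "?q v = 0" if "v \<notin> ?B" for v
  proof -
    have "(\<lambda>w. f (Y w)) -` {v} \<inter> space N = {}" using that by auto
    then show ?thesis by simp
  qed
  \<comment> \<open>The two images may differ in values of probability zero, hence the sum over
    their union.\<close>
  have "(\<Sum>v\<in>?A. ?p v * log b (?p v)) = (\<Sum>v\<in>?A \<union> ?B. ?p v * log b (?p v))"
    using fin p0 by (intro sum.mono_neutral_left) auto
  also have "\<dots> = (\<Sum>v\<in>?A \<union> ?B. ?q v * log b (?q v))" by (simp add: pq)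
  also have "\<dots> = (\<Sum>v\<in>?B. ?q v * log b (?q v))"
    using fin q0 by (intro sum.mono_neutral_right) auto
  finally show ?thesis by (simp add: M.entropy_eq_sum[OF fX] N.entropy_eq_sum[OF fY])
qed

section \<open>Common information of a linear source\<close>

locale linear_source = information_space M b for M :: "'w measure" and b +
  fixes m l :: nat and Z :: "nat \<Rightarrow> 'w \<Rightarrow> 'z"
    and x :: "'w \<Rightarrow> 'q :: {field, finite} vec" and A :: "nat \<Rightarrow> 'q mat"
  assumes m: "1 \<le> m" and source: "finite_linear_source b {1..m} M Z l x A"
begin

definition "C i = column_space l (A i)"

definition "W j = (\<Inter>i\<in>{1..j}. C i)"

lemma Z_simple: "i \<in> {1..m} \<Longrightarrow> simple_function M (Z i)"
  and x_meas: "x \<in> measurable M (count_space (carrier_vec l))"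
  and x_uniform: "distr M (count_space (carrier_vec l)) x = uniform_count_measure (carrier_vec l)"
  and A_dim: "i \<in> {1..m} \<Longrightarrow> dim_row (A i) = l"
  and Z_equiv: "i \<in> {1..m} \<Longrightarrow> equivalent_rv b M (Z i) (\<lambda>w. row_times (x w) (A i))"
  using source by (auto simp: finite_linear_source_def)

lemma x_carrier: "w \<in> space M \<Longrightarrow> x w \<in> carrier_vec l"
  using measurable_space[OF x_meas] by simp

lemmas x_simple = simple_function_uniform[OF x_meas]

lemma C_subspace: "i \<in> {1..m} \<Longrightarrow> vec_subspace l (C i)"
  unfolding C_def by (rule column_space_subspace[OF A_dim])

lemma W_subspace: "1 \<le> j \<Longrightarrow> j \<le> m \<Longrightarrow> vec_subspace l (W j)"
  unfolding W_def by (intro vec_subspace_Inter C_subspace) auto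

lemma W_Suc: "W (Suc j) = W j \<inter> C (Suc j)"
  by (simp add: W_def atLeastAtMostSuc_conv Int_commute)

lemma W_1: "W 1 = C 1"
  by (simp add: W_def)

lemma row_times_functionals:
  assumes B: "dim_row B = l"
  shows "\<exists>f. \<forall>w\<in>space M. functionals (column_space l B) (x w) = f (row_times (x w) B)"
    and "\<exists>f. \<forall>w\<in>space M. row_times (x w) B = f (functionals (column_space l B) (x w))"
proof -
  have factor: "\<exists>f. \<forall>w\<in>space M. U w = f (V w)"
    if "\<And>v w. v \<in> space M \<Longrightarrow> w \<in> space M \<Longrightarrow> V v = V w \<Longrightarrow> U v = U w" for U :: "'w \<Rightarrow> 'u" and V :: "'w \<Rightarrow> 'v"
  proof (intro exI ballI)
    fix w assume w: "w \<in> space M"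
    then have "(SOME v. v \<in> space M \<and> V v = V w) \<in> space M \<and> V (SOME v. v \<in> space M \<and> V v = V w) = V w"
      by (intro someI_ex[of "\<lambda>v. v \<in> space M \<and> V v = V w"]) auto
    then show "U w = (\<lambda>y. U (SOME v. v \<in> space M \<and> V v = y)) (V w)" using that w by metis
  qed
  show "\<exists>f. \<forall>w\<in>space M. functionals (column_space l B) (x w) = f (row_times (x w) B)"
    by (rule factor) (simp add: functionals_column_space_eq_iff[OF B x_carrier x_carrier])
  show "\<exists>f. \<forall>w\<in>space M. row_times (x w) B = f (functionals (column_space l B) (x w))"
    by (rule factor) (simp add: functionals_column_space_eq_iff[OF B x_carrier x_carrier, symmetric])
qed

lemma Z_functionals:
  assumes i: "i \<in> {1..m}"
  shows "\<exists>f. AE w in M. functionals (C i) (x w) = f (Z i w)"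
    and "\<exists>f. AE w in M. Z i w = f (functionals (C i) (x w))"
proof -
  obtain g h where g: "\<forall>w\<in>space M. functionals (C i) (x w) = g (row_times (x w) (A i))"
    and h: "\<forall>w\<in>space M. row_times (x w) (A i) = h (functionals (C i) (x w))"
    using row_times_functionals[OF A_dim[OF i]] unfolding C_def by blast
  obtain g' h' where g': "AE w in M. row_times (x w) (A i) = g' (Z i w)"
    and h': "AE w in M. Z i w = h' (row_times (x w) (A i))"
    using Z_equiv[OF i] unfolding equivalent_rv_def
      conditional_entropy_eq_0_iff[OF Z_simple[OF i] x_simple[of "\<lambda>v. row_times v (A i)"]]
      conditional_entropy_eq_0_iff[OF x_simple[of "\<lambda>v. row_times v (A i)"] Z_simple[OF i]]
    by blast
  have "AE w in M. functionals (C i) (x w) = (g \<circ> g') (Z i w)"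
    using g' AE_space by eventually_elim (simp add: g)
  then show "\<exists>f. AE w in M. functionals (C i) (x w) = f (Z i w)" by blast
  have "AE w in M. Z i w = (h' \<circ> h) (functionals (C i) (x w))"
    using h' AE_space by eventually_elim (simp add: h)
  then show "\<exists>f. AE w in M. Z i w = f (functionals (C i) (x w))" by blast
qed

lemma entropy_x: "vec_subspace l S \<Longrightarrow> \<H>(\<lambda>w. functionals S (x w)) = log b (card S)"
  by (rule entropy_functionals[OF x_meas x_uniform])

lemma common_rv_entropy_le:
  assumes G: "common_rv b {1..m} M Z G"
  shows "\<H>(G) \<le> log b (card (W m))"
proof -
  have Gs: "simple_function M G" using G by (simp add: common_rv_def)
  have cond: "\<H>(G | \<lambda>w. ((), functionals (C i) (x w))) \<le> 0" if i: "i \<in> {1..m}" for i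
  proof -
    have "\<H>(G | Z i) = 0" using G i by (simp add: common_rv_def)
    then obtain f where f: "AE w in M. G w = f (Z i w)"
      using conditional_entropy_eq_0_iff[OF Gs Z_simple[OF i]] by blast
    obtain h where h: "AE w in M. Z i w = h (functionals (C i) (x w))" using Z_functionals(2)[OF i] ..
    have "AE w in M. G w = (f \<circ> h \<circ> snd) ((), functionals (C i) (x w))"
      using f h by eventually_elim simp
    then have "\<exists>f. AE w in M. G w = f ((), functionals (C i) (x w))" by blast
    then show ?thesis
      using conditional_entropy_eq_0_iff[OF Gs x_simple[of "\<lambda>v. ((), functionals (C i) v)"]] by simp
  qed
  have restr: "\<exists>f. AE w in M. functionals S (x w) = f (functionals T (x w))" if "S \<subseteq> T" for S T
    using functionals_restrict[OF that]
    by (intro exI[of _ "\<lambda>g s. if s \<in> S then g s else 0"] AE_I2) blast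
  \<comment> \<open>The unit value plays the discussion and the recovery terms vanish, so only the
    last summand survives.\<close>
  have "\<H>(G | \<lambda>_. ()) \<le> real m * 0 + real (m - 1) * \<H>(\<lambda>_. ()) + \<H>(\<lambda>w. functionals (W m) (x w))"
  proof (rule conditional_entropy_common_chain[where T="\<lambda>i w. functionals (C i) (x w)"])
    fix j assume j: "1 \<le> j" "j < m"
    then have sub: "vec_subspace l (W j)" "vec_subspace l (C (Suc j))" "vec_subspace l (W (Suc j))"
      by (auto intro: W_subspace C_subspace)
    show "\<exists>f. AE w in M. functionals (W (Suc j)) (x w) = f (functionals (W j) (x w))"
      "\<exists>f. AE w in M. functionals (W (Suc j)) (x w) = f (functionals (C (Suc j)) (x w))"
      by (auto intro!: restr simp: W_Suc)
    show "\<H>(\<lambda>w. functionals (W j) (x w)) + \<H>(\<lambda>w. functionals (C (Suc j)) (x w))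
        \<le> \<H>(\<lambda>w. (functionals (W j) (x w), functionals (C (Suc j)) (x w))) + \<H>(\<lambda>w. functionals (W (Suc j)) (x w))"
      using entropy_functionals_pair[OF x_meas x_uniform sub(1,2)] sub by (simp add: entropy_x W_Suc)
  qed (use Gs cond m x_simple W_1 in auto)
  moreover have "\<H>(G | \<lambda>_. ()) = \<H>(G)"
  proof -
    have "\<H>(\<lambda>w. (G w, ())) = \<H>(G)"
      using Gs by (intro antisym entropy_mono_kernel simple_function_Pair) auto
    then show ?thesis
      using conditional_entropy_eq_diff[OF Gs simple_function_const, of "()"] entropy_const[of "()"] by linarith
  qed
  ultimately show ?thesis
    using entropy_const[of "()"] entropy_x[OF W_subspace[OF m order_refl]] by (metis add.right_neutral add_0 mult_zero_right)
qed

text \<open>\<open>W m\<close> lies in every \<open>C i\<close>, so its functionals are restrictions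
  of those of \<open>C i\<close>, which each source determines almost surely.\<close>

lemma row_times_common:
  assumes B: "dim_row B = l" and col: "column_space l B = W m"
  shows "common_rv b {1..m} M Z (\<lambda>w. row_times (x w) B)"
    and "\<H>(\<lambda>w. row_times (x w) B) = log b (card (W m))"
proof -
  obtain g h where g: "\<forall>w\<in>space M. functionals (W m) (x w) = g (row_times (x w) B)"
    and h: "\<forall>w\<in>space M. row_times (x w) B = h (functionals (W m) (x w))"
    using row_times_functionals[OF B] unfolding col by blast
  have "\<H>(\<lambda>w. row_times (x w) B) = \<H>(\<lambda>w. functionals (W m) (x w))"
    using g h by (intro antisym entropy_mono[where f=h] entropy_mono[where f=g] x_simple) auto
  then show "\<H>(\<lambda>w. row_times (x w) B) = log b (card (W m))"
    using entropy_x[OF W_subspace[OF m order_refl]] by simp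
  have "\<H>(\<lambda>w. row_times (x w) B | Z i) = 0" if i: "i \<in> {1..m}" for i
  proof -
    obtain f where f: "AE w in M. functionals (C i) (x w) = f (Z i w)" using Z_functionals(1)[OF i] ..
    have sub: "W m \<subseteq> C i" using i by (auto simp: W_def)
    define f' where "f' y = h (\<lambda>s. if s \<in> W m then f y s else 0)" for y
    have "AE w in M. row_times (x w) B = f' (Z i w)"
      using f AE_space by eventually_elim (simp add: f'_def h functionals_restrict[OF sub] cong: if_cong)
    then show ?thesis
      unfolding conditional_entropy_eq_0_iff[OF x_simple[of "\<lambda>v. row_times v B"] Z_simple[OF i]] by blast
  qed
  then show "common_rv b {1..m} M Z (\<lambda>w. row_times (x w) B)"
    using x_simple by (simp add: common_rv_def)
qed

lemma J_GK_eq: "J_GK b {1..m} M Z = ereal (log b (card (W m)))"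
proof (rule antisym)
  show "J_GK b {1..m} M Z \<le> ereal (log b (card (W m)))"
    unfolding J_GK_def using common_rv_entropy_le by (intro SUP_least) auto
  obtain B where B: "dim_row B = l" "column_space l B = W m"
    using subspace_as_column_space[OF W_subspace[OF m order_refl]] by blast
  let ?G = "\<lambda>w. row_times (x w) B"
  have sG: "simple_function M ?G" by (rule x_simple)
  \<comment> \<open>\<open>J_GK\<close> ranges over variables with values in the naturals, so the
    vectors are numbered.\<close>
  define e where "e = to_nat_on (?G ` space M)"
  have "inj_on e (?G ` space M)"
    unfolding e_def using simple_functionD(1)[OF sG] by (intro inj_on_to_nat_on countable_finite)
  then have "\<H>(e \<circ> ?G) = log b (card (W m))"
    using entropy_of_inj[OF sG] row_times_common(2)[OF B] by simp
  moreover have "common_rv b {1..m} M Z (e \<circ> ?G)"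
    unfolding common_rv_def
  proof (intro conjI ballI)
    show sf: "simple_function M (e \<circ> ?G)" by (rule simple_function_compose[OF sG])
    fix i assume i: "i \<in> {1..m}"
    then have "\<H>(?G | Z i) = 0" using row_times_common(1)[OF B] by (simp add: common_rv_def)
    then obtain f where "AE w in M. ?G w = f (Z i w)"
      using conditional_entropy_eq_0_iff[OF sG Z_simple[OF i]] by blast
    then have "AE w in M. (e \<circ> ?G) w = (e \<circ> f) (Z i w)" by eventually_elim simp
    then show "\<H>(e \<circ> ?G | Z i) = 0"
      using conditional_entropy_eq_0_iff[OF sf Z_simple[OF i]] by blast
  qed
  ultimately show "ereal (log b (card (W m))) \<le> J_GK b {1..m} M Z"
    unfolding J_GK_def by (intro SUP_upper2[of "e \<circ> ?G"]) auto
qed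

end

section \<open>Converse\<close>

context linear_source
begin

section \<open>A substitute for the vector underlying the source symbols\<close>

definition Z_joint :: "'w \<Rightarrow> nat \<Rightarrow> 'z" where
  "Z_joint w = (\<lambda>i\<in>{1..m}. Z i w)"

text \<open>\<open>coordinates\<close> and \<open>symbol\<close> are inverse to each other up to
  null sets. Being chosen once for the source, they can be applied to the symbols of any
  scheme.\<close>

definition "coordinates i = (SOME f. AE w in M. functionals (C i) (x w) = f (Z i w))"

definition "symbol i = (SOME f. AE w in M. Z i w = f (functionals (C i) (x w)))"

text \<open>Some vector consistent with given values of the sources. A scheme only provides copies of
  the sources, and this serves as the vector \<open>x\<close> underlying them.\<close>

definition lift :: "(nat \<Rightarrow> 'z) \<Rightarrow> 'q vec" where
  "lift z = (if \<exists>v\<in>carrier_vec l. \<forall>i\<in>{1..m}. functionals (C i) v = coordinates i (z i)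
     then SOME v. v \<in> carrier_vec l \<and> (\<forall>i\<in>{1..m}. functionals (C i) v = coordinates i (z i))
     else 0\<^sub>v l)"

lemma lift_carrier: "lift z \<in> carrier_vec l"
proof (cases "\<exists>v\<in>carrier_vec l. \<forall>i\<in>{1..m}. functionals (C i) v = coordinates i (z i)")
  case True
  then have "\<exists>v. v \<in> carrier_vec l \<and> (\<forall>i\<in>{1..m}. functionals (C i) v = coordinates i (z i))" by blast
  from someI_ex[OF this] True show ?thesis unfolding lift_def by (subst if_P) auto
next
  case False
  then show ?thesis unfolding lift_def by (subst if_not_P) auto
qed

lemma lift_coordinates:
  assumes "v \<in> carrier_vec l" "\<And>i. i \<in> {1..m} \<Longrightarrow> functionals (C i) v = coordinates i (z i)" "i \<in> {1..m}"
  shows "functionals (C i) (lift z) = coordinates i (z i)"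
proof -
  have ex: "\<exists>v. v \<in> carrier_vec l \<and> (\<forall>i\<in>{1..m}. functionals (C i) v = coordinates i (z i))"
    using assms(1,2) by blast
  then have "lift z = (SOME v. v \<in> carrier_vec l \<and> (\<forall>i\<in>{1..m}. functionals (C i) v = coordinates i (z i)))"
    unfolding lift_def by (subst if_P) auto
  with someI_ex[OF ex] assms(3) show ?thesis by simp
qed

lemma AE_coordinates: "i \<in> {1..m} \<Longrightarrow> AE w in M. functionals (C i) (x w) = coordinates i (Z i w)"
  unfolding coordinates_def by (rule someI_ex[OF Z_functionals(1)])

lemma AE_symbol: "i \<in> {1..m} \<Longrightarrow> AE w in M. Z i w = symbol i (functionals (C i) (x w))"
  unfolding symbol_def by (rule someI_ex[OF Z_functionals(2)])

text \<open>Almost surely \<open>x w\<close> itself is consistent with the source values, so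
  \<open>lift\<close> finds a vector, and it has the same functionals on every \<open>C i\<close>.
  It need not equal \<open>x w\<close>; this is why the block entropies are computed only for
  subspaces inside some \<open>C i\<close>.\<close>

lemma AE_lift:
  "AE w in M. \<forall>i\<in>{1..m}. functionals (C i) (lift (Z_joint w)) = functionals (C i) (x w)
     \<and> coordinates i (Z_joint w i) = functionals (C i) (x w) \<and> Z_joint w i = symbol i (functionals (C i) (x w))"
proof -
  have "AE w in M. \<forall>i\<in>{1..m}. functionals (C i) (x w) = coordinates i (Z i w) \<and> Z i w = symbol i (functionals (C i) (x w))"
    using AE_coordinates AE_symbol by (intro AE_finite_allI AE_conjI) auto
  with AE_space show ?thesis
  proof eventually_elim
    case (elim w)
    have Zj: "Z_joint w i = Z i w" if "i \<in> {1..m}" for i using that by (simp add: Z_joint_def)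
    have 1: "functionals (C i) (x w) = coordinates i (Z_joint w i)" if "i \<in> {1..m}" for i
      unfolding Zj[OF that] using elim(2) that by blast
    have 2: "Z_joint w i = symbol i (functionals (C i) (x w))" if "i \<in> {1..m}" for i
      unfolding Zj[OF that] using elim(2) that by blast
    have 3: "functionals (C i) (lift (Z_joint w)) = functionals (C i) (x w)" if "i \<in> {1..m}" for i
      unfolding 1[OF that] by (rule lift_coordinates[OF x_carrier[OF elim(1)] 1 that])
    show ?case by (intro ballI conjI 1[symmetric] 2 3)
  qed
qed

lemma functionals_eq_subset: "functionals T v = functionals T w \<Longrightarrow> S \<subseteq> T \<Longrightarrow> functionals S v = functionals S w"
  by (auto simp: functionals_eq_iff)

lemma Z_joint_simple: "simple_function M Z_joint"
  unfolding simple_function_def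
proof (intro conjI ballI)
  have "finite (Pi\<^sub>E {1..m} (\<lambda>i. Z i ` space M))"
    using simple_functionD(1)[OF Z_simple] by (intro finite_PiE) auto
  moreover have "Z_joint ` space M \<subseteq> Pi\<^sub>E {1..m} (\<lambda>i. Z i ` space M)"
    by (auto simp: Z_joint_def)
  ultimately show "finite (Z_joint ` space M)" by (rule rev_finite_subset)
  fix z assume "z \<in> Z_joint ` space M"
  then have "Z_joint -` {z} \<inter> space M = (\<Inter>i\<in>{1..m}. Z i -` {z i} \<inter> space M)"
    using m by (auto simp: Z_joint_def fun_eq_iff restrict_def split: if_splits)
  also have "\<dots> \<in> events"
    using m simple_functionD(2)[OF Z_simple] by (intro sets.finite_INT) auto
  finally show "Z_joint -` {z} \<inter> space M \<in> events" .
qed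

lemma Z_joint_measurable: "Z_joint \<in> measurable M (count_space UNIV)"
  by (rule measurable_simple_function[OF Z_joint_simple])

lemma simple_function_lift: "simple_function M (\<lambda>w. f (lift (Z_joint w)))"
proof -
  have "(\<lambda>w. lift (Z_joint w)) \<in> measurable M (count_space (carrier_vec l))"
    using measurable_compose[OF Z_joint_measurable, of lift "count_space (carrier_vec l)"] lift_carrier by auto
  then show ?thesis by (rule simple_function_uniform)
qed

end

section \<open>Blocks observed in a scheme\<close>

locale source_scheme = linear_source M b m l Z x A
  for M :: "'w measure" and b and m l :: nat and Z :: "nat \<Rightarrow> 'w \<Rightarrow> 'z"
    and x :: "'w \<Rightarrow> 'q :: {field, finite} vec" and A :: "nat \<Rightarrow> 'q mat" +
  fixes n :: nat and S :: "'z sk_scheme"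
  assumes valid: "valid_scheme {1..m} M Z n S"
begin

abbreviation "N \<equiv> measure_pmf (sk_law S)"

sublocale N: information_space N b
  by (simp add: information_space_def information_space_axioms_def measure_pmf.prob_space_axioms b_gt_1)

lemma prob_space_N: "prob_space N"
  by (rule measure_pmf.prob_space_axioms)

lemma simple_N: "finite (range X) \<Longrightarrow> simple_function N X"
  by (auto simp: simple_function_def)

definition "obs \<omega> = (\<lambda>t\<in>{..<n}. \<lambda>i\<in>{1..m}. sk_obs S i t \<omega>)"

definition "priv \<omega> = (\<lambda>i\<in>{1..m}. sk_priv S i \<omega>)"

definition "block f \<omega> = map (\<lambda>t. f (lift (obs \<omega> t))) [0..<n]"

lemma obs_indep: "prob_space.indep_vars N (\<lambda>_. count_space UNIV) (\<lambda>t \<omega>. obs \<omega> t) {..<n}"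
  using valid unfolding valid_scheme_def
  by (subst prob_space.indep_vars_cong[OF prob_space_N, of "{..<n}" "{..<n}" _ "\<lambda>t \<omega>. \<lambda>i\<in>{1..m}. sk_obs S i t \<omega>" _ "\<lambda>_. count_space UNIV"])
    (auto simp: obs_def)

lemma obs_distr:
  "t < n \<Longrightarrow> distr N (count_space UNIV) (\<lambda>\<omega>. obs \<omega> t) = distr M (count_space UNIV) Z_joint"
  using valid by (simp add: valid_scheme_def obs_def Z_joint_def[abs_def])

text \<open>Each time instant has the law of \<open>Z_joint\<close>, so almost sure statements about
  the source pass to the sample space of the scheme.\<close>

lemma AE_obs:
  assumes t: "t < n" and P: "AE w in M. P (Z_joint w)"
  shows "AE \<omega> in N. P (obs \<omega> t)"
proof -
  have "AE z in distr M (count_space UNIV) Z_joint. P z"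
    using P by (subst AE_distr_iff[OF Z_joint_measurable]) auto
  then show ?thesis
    unfolding obs_distr[OF t, symmetric] by (subst (asm) AE_distr_iff) auto
qed

lemma finite_lift: "finite (range (\<lambda>\<omega>. f (lift (g \<omega>))))"
proof -
  have "range (\<lambda>\<omega>. f (lift (g \<omega>))) \<subseteq> f ` carrier_vec l" using lift_carrier by auto
  then show ?thesis by (rule finite_subset) (intro finite_imageI finite_carrier_vec)
qed

lemma range_block: "range (block f) \<subseteq> {xs. set xs \<subseteq> f ` carrier_vec l \<and> length xs = n}"
  using lift_carrier by (auto simp: block_def)

lemma block_simple: "simple_function N (block f)"
  by (intro simple_N finite_subset[OF range_block] finite_lists_length_eq finite_imageI finite_carrier_vec)

lemma entropy_block: "rv_entropy b N (block f) = n * \<H>(\<lambda>w. f (lift (Z_joint w)))"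
proof -
  have ind: "prob_space.indep_vars N (\<lambda>_. count_space UNIV) (\<lambda>t \<omega>. f (lift (obs \<omega> t))) {..<n}"
    using prob_space.indep_vars_compose2[OF prob_space_N obs_indep, of "\<lambda>_ z. f (lift z)" "\<lambda>_. count_space UNIV"] by simp
  have "rv_entropy b N (block f) = (\<Sum>t<n. rv_entropy b N (\<lambda>\<omega>. f (lift (obs \<omega> t))))"
    unfolding block_def[abs_def] by (rule N.entropy_indep_list(2)[OF ind simple_N[OF finite_lift]])
  also have "\<dots> = (\<Sum>t<n. \<H>(\<lambda>w. f (lift (Z_joint w))))"
  proof (rule sum.cong[OF refl])
    fix t assume "t \<in> {..<n}"
    then show "rv_entropy b N (\<lambda>\<omega>. f (lift (obs \<omega> t))) = \<H>(\<lambda>w. f (lift (Z_joint w)))"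
      using simple_N[OF finite_lift] simple_function_lift
      by (intro entropy_eq_of_distr_eq[where f="\<lambda>z. f (lift z)" and X="\<lambda>\<omega>. obs \<omega> t" and Y=Z_joint]
          N.information_space_axioms information_space_axioms Z_joint_measurable obs_distr) auto
  qed
  finally show ?thesis by simp
qed

lemma entropy_block_functionals:
  assumes U: "vec_subspace l U" "U \<subseteq> C i" "i \<in> {1..m}"
  shows "rv_entropy b N (block (functionals U)) = n * log b (card U)"
proof -
  have "\<H>(\<lambda>w. functionals U (lift (Z_joint w))) = \<H>(\<lambda>w. functionals U (x w))"
  proof (rule entropy_cong_AE[OF simple_function_lift x_simple])
    show "AE w in M. functionals U (lift (Z_joint w)) = functionals U (x w)"
      using AE_lift by eventually_elim (use U functionals_eq_subset in blast)
  qed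
  then show ?thesis unfolding entropy_block entropy_x[OF U(1)] by simp
qed

lemma entropy_block_pair:
  assumes U: "vec_subspace l U" "U \<subseteq> C i" "i \<in> {1..m}" and T: "vec_subspace l T" "T \<subseteq> C k" "k \<in> {1..m}"
  shows "rv_entropy b N (\<lambda>\<omega>. (block (functionals U) \<omega>, block (functionals T) \<omega>)) + n * log b (card (U \<inter> T))
    = n * log b (card U) + n * log b (card T)"
proof -
  let ?f = "\<lambda>v. (functionals U v, functionals T v)"
  have "\<H>(\<lambda>w. ?f (lift (Z_joint w))) = \<H>(\<lambda>w. ?f (x w))"
  proof (rule entropy_cong_AE[OF simple_function_lift x_simple])
    show "AE w in M. ?f (lift (Z_joint w)) = ?f (x w)"
      using AE_lift by eventually_elim (use U T functionals_eq_subset in blast)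
  qed
  moreover have "rv_entropy b N (\<lambda>\<omega>. (block (functionals U) \<omega>, block (functionals T) \<omega>)) = rv_entropy b N (block ?f)"
    by (intro antisym N.entropy_mono_kernel simple_function_Pair block_simple) (auto simp: block_def)
  ultimately show ?thesis
    using entropy_functionals_pair[OF x_meas x_uniform U(1) T(1)]
    unfolding entropy_block by (simp add: distrib_left[symmetric])
qed

lemma entropy_priv_obs:
  assumes F: "finite (range (\<lambda>\<omega>. f (priv \<omega>)))" and G: "finite (range (\<lambda>\<omega>. g (obs \<omega>)))"
  shows "rv_entropy b N (\<lambda>\<omega>. (f (priv \<omega>), g (obs \<omega>)))
    = rv_entropy b N (\<lambda>\<omega>. f (priv \<omega>)) + rv_entropy b N (\<lambda>\<omega>. g (obs \<omega>))"
proof (rule N.entropy_indep[OF simple_N[OF F] simple_N[OF G]])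
  have "map_pmf (\<lambda>\<omega>. (priv \<omega>, obs \<omega>)) (sk_law S) = pair_pmf (map_pmf priv (sk_law S)) (map_pmf obs (sk_law S))"
    using valid by (simp add: valid_scheme_def priv_def[abs_def] obs_def[abs_def])
  then have "map_pmf (map_prod f g) (map_pmf (\<lambda>\<omega>. (priv \<omega>, obs \<omega>)) (sk_law S))
      = map_pmf (map_prod f g) (pair_pmf (map_pmf priv (sk_law S)) (map_pmf obs (sk_law S)))"
    by simp
  then have eq: "map_pmf (\<lambda>\<omega>. (f (priv \<omega>), g (obs \<omega>))) (sk_law S)
      = pair_pmf (map_pmf (\<lambda>\<omega>. f (priv \<omega>)) (sk_law S)) (map_pmf (\<lambda>\<omega>. g (obs \<omega>)) (sk_law S))"
    by (simp add: map_pmf_comp pair_map_pmf1 pair_map_pmf2 map_prod_def split_def)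
  fix a c
  show "measure N ((\<lambda>\<omega>. (f (priv \<omega>), g (obs \<omega>))) -` {(a, c)} \<inter> space N)
    = measure N ((\<lambda>\<omega>. f (priv \<omega>)) -` {a} \<inter> space N) * measure N ((\<lambda>\<omega>. g (obs \<omega>)) -` {c} \<inter> space N)"
    using arg_cong[OF eq, of "\<lambda>p. pmf p (a, c)"] by (simp add: pmf_map pmf_pair)
qed

lemma entropy_priv_pair:
  assumes ik: "i \<in> {1..m}" "k \<in> {1..m}" "i \<noteq> k"
    and F: "finite (range f)" and G: "finite (range g)"
  shows "rv_entropy b N (\<lambda>\<omega>. (f (sk_priv S i \<omega>), g (sk_priv S k \<omega>)))
    = rv_entropy b N (\<lambda>\<omega>. f (sk_priv S i \<omega>)) + rv_entropy b N (\<lambda>\<omega>. g (sk_priv S k \<omega>))"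
proof (rule N.entropy_indep)
  show "simple_function N (\<lambda>\<omega>. f (sk_priv S i \<omega>))" "simple_function N (\<lambda>\<omega>. g (sk_priv S k \<omega>))"
    using F G by (auto intro!: simple_N intro: finite_subset[OF _ F] finite_subset[OF _ G])
  fix a c
  have ind: "prob_space.indep_vars N (\<lambda>_. count_space UNIV) (sk_priv S) {1..m}"
    using valid by (simp add: valid_scheme_def)
  define E where "E j = (if j = i then f -` {a} else g -` {c})" for j
  have "measure N (\<Inter>j\<in>{i, k}. sk_priv S j -` E j \<inter> space N) = (\<Prod>j\<in>{i, k}. measure N (sk_priv S j -` E j \<inter> space N))"
    using ik by (intro prob_space.indep_varsD[OF prob_space_N ind]) auto
  moreover have "(\<Inter>j\<in>{i, k}. sk_priv S j -` E j \<inter> space N)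
      = (\<lambda>\<omega>. (f (sk_priv S i \<omega>), g (sk_priv S k \<omega>))) -` {(a, c)} \<inter> space N"
    using ik by (auto simp: E_def)
  moreover have "sk_priv S i -` E i = (\<lambda>\<omega>. f (sk_priv S i \<omega>)) -` {a}"
    "sk_priv S k -` E k = (\<lambda>\<omega>. g (sk_priv S k \<omega>)) -` {c}"
    using ik by (auto simp: E_def)
  ultimately show "measure N ((\<lambda>\<omega>. (f (sk_priv S i \<omega>), g (sk_priv S k \<omega>))) -` {(a, c)} \<inter> space N)
    = measure N ((\<lambda>\<omega>. f (sk_priv S i \<omega>)) -` {a} \<inter> space N) * measure N ((\<lambda>\<omega>. g (sk_priv S k \<omega>)) -` {c} \<inter> space N)"
    using ik by simp
qed

text \<open>Private parts are independent of each other and of the source, so they add at most H(f)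
  + H(g) on the left and exactly this on the right; the rest is n times the single-letter identity.
  The constant \<open>c\<close> fills the private slot of the common part, which is thus free of
  private randomness.\<close>

lemma conditional_independence_block:
  assumes ik: "i \<in> {1..m}" "k \<in> {1..m}" "i \<noteq> k"
    and f: "finite (range f)" and g: "finite (range g)"
    and U: "vec_subspace l U" "U \<subseteq> C i" and T: "vec_subspace l T" "T \<subseteq> C k"
  shows "rv_entropy b N (\<lambda>\<omega>. (f (sk_priv S i \<omega>), block (functionals U) \<omega>))
      + rv_entropy b N (\<lambda>\<omega>. (g (sk_priv S k \<omega>), block (functionals T) \<omega>))
    \<le> rv_entropy b N (\<lambda>\<omega>. ((f (sk_priv S i \<omega>), block (functionals U) \<omega>), (g (sk_priv S k \<omega>), block (functionals T) \<omega>)))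
      + rv_entropy b N (\<lambda>\<omega>. (c, block (functionals (U \<inter> T)) \<omega>))"
proof -
  let ?f = "\<lambda>\<omega>. f (sk_priv S i \<omega>)" and ?g = "\<lambda>\<omega>. g (sk_priv S k \<omega>)"
  let ?U = "block (functionals U)" and ?T = "block (functionals T)"
  have fin: "finite (range ?f)" "finite (range ?g)"
    by (auto intro: finite_subset[OF _ f] finite_subset[OF _ g])
  note sf = simple_N[OF fin(1)] simple_N[OF fin(2)] block_simple simple_function_Pair simple_function_const
  have "rv_entropy b N (\<lambda>\<omega>. ((?f \<omega>, ?g \<omega>), (?U \<omega>, ?T \<omega>)))
      = rv_entropy b N (\<lambda>\<omega>. (?f \<omega>, ?g \<omega>)) + rv_entropy b N (\<lambda>\<omega>. (?U \<omega>, ?T \<omega>))"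
  proof -
    define \<phi> where "\<phi> p = (f (p i), g (p k))" for p
    define \<psi> where "\<psi> o' = (map (\<lambda>t. functionals U (lift (o' t))) [0..<n], map (\<lambda>t. functionals T (lift (o' t))) [0..<n])" for o'
    have eqs: "(\<lambda>\<omega>. (?f \<omega>, ?g \<omega>)) = (\<lambda>\<omega>. \<phi> (priv \<omega>))" "(\<lambda>\<omega>. (?U \<omega>, ?T \<omega>)) = (\<lambda>\<omega>. \<psi> (obs \<omega>))"
      using ik by (auto simp: \<phi>_def \<psi>_def priv_def block_def)
    have "finite (range (\<lambda>\<omega>. (?f \<omega>, ?g \<omega>)))" "finite (range (\<lambda>\<omega>. (?U \<omega>, ?T \<omega>)))"
      using simple_functionD(1)[OF simple_function_Pair[OF sf(1,2)]]
        simple_functionD(1)[OF simple_function_Pair[OF block_simple[of "functionals U"] block_simple[of "functionals T"]]]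
      by auto
    then have "rv_entropy b N (\<lambda>\<omega>. (\<phi> (priv \<omega>), \<psi> (obs \<omega>)))
        = rv_entropy b N (\<lambda>\<omega>. \<phi> (priv \<omega>)) + rv_entropy b N (\<lambda>\<omega>. \<psi> (obs \<omega>))"
      unfolding eqs by (rule entropy_priv_obs)
    moreover have "(\<lambda>\<omega>. ((?f \<omega>, ?g \<omega>), (?U \<omega>, ?T \<omega>))) = (\<lambda>\<omega>. (\<phi> (priv \<omega>), \<psi> (obs \<omega>)))"
      using eqs by (simp add: fun_eq_iff)
    ultimately show ?thesis by (simp only: eqs)
  qed
  also have "rv_entropy b N (\<lambda>\<omega>. (?f \<omega>, ?g \<omega>)) = rv_entropy b N ?f + rv_entropy b N ?g"
    by (rule entropy_priv_pair[OF ik f g])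
  finally have 1: "rv_entropy b N (\<lambda>\<omega>. ((?f \<omega>, ?g \<omega>), (?U \<omega>, ?T \<omega>)))
      = rv_entropy b N ?f + rv_entropy b N ?g + rv_entropy b N (\<lambda>\<omega>. (?U \<omega>, ?T \<omega>))" .
  have 2: "rv_entropy b N (\<lambda>\<omega>. ((?f \<omega>, ?U \<omega>), (?g \<omega>, ?T \<omega>))) = rv_entropy b N (\<lambda>\<omega>. ((?f \<omega>, ?g \<omega>), (?U \<omega>, ?T \<omega>)))"
    by (intro antisym N.entropy_mono_kernel sf) auto
  have 3: "rv_entropy b N (\<lambda>\<omega>. (c, block (functionals (U \<inter> T)) \<omega>)) = rv_entropy b N (block (functionals (U \<inter> T)))"
    by (intro antisym N.entropy_mono_kernel sf) auto
  have UT: "vec_subspace l (U \<inter> T)"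
    using vec_subspace_Inter[of "{U, T}" l "\<lambda>U. U"] U T by auto
  have UTC: "U \<inter> T \<subseteq> C i" using U by auto
  have "rv_entropy b N (\<lambda>\<omega>. (?f \<omega>, ?U \<omega>)) \<le> rv_entropy b N ?f + rv_entropy b N ?U"
    "rv_entropy b N (\<lambda>\<omega>. (?g \<omega>, ?T \<omega>)) \<le> rv_entropy b N ?g + rv_entropy b N ?T"
    by (intro N.entropy_subadditive sf)+
  moreover note entropy_block_functionals[OF U ik(1)] entropy_block_functionals[OF T ik(2)]
    entropy_block_functionals[OF UT UTC ik(1)]
  moreover note entropy_block_pair[OF U ik(1) T ik(2)]
  ultimately show ?thesis unfolding 1 2 3 by linarith
qed

end

text \<open>Here \<open>k n\<close> is the key rate, to which the Fano term is proportional. As no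
  bound on \<open>k\<close> is assumed, that term cannot be sent to zero directly; it is absorbed on
  the left as a factor 1 - p \<epsilon>.\<close>

lemma liminf_le_of_linear_bound:
  fixes k gap \<phi> \<epsilon> :: "nat \<Rightarrow> real"
  assumes bound: "\<And>n. n \<ge> 1 \<Longrightarrow> k n \<le> gap n + (c + p * \<epsilon> n * (k n * n)) / n + d * \<phi> n + J"
    and gap: "limsup (\<lambda>n. ereal (gap n)) \<le> 0" and \<phi>: "limsup (\<lambda>n. ereal (\<phi> n)) \<le> 0"
    and \<epsilon>: "\<epsilon> \<longlonglongrightarrow> 0" and J: "J \<ge> 0" and d: "d \<ge> 0"
  shows "liminf (\<lambda>n. ereal (k n)) \<le> ereal J"
proof (rule ccontr)
  assume "\<not> ?thesis"
  then obtain r where r: "ereal J < ereal r" "ereal r < liminf (\<lambda>n. ereal (k n))"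
    using ereal_dense3[of "ereal J"] ereal_dense2 by (metis not_le)
  \<comment> \<open>Five shares: the gap, c / n, d \<phi> and the loss p \<epsilon> r use up at most
    one each, and the fifth yields the contradiction.\<close>
  define t where "t = (r - J) / 5"
  have t: "t > 0" "r = J + 5 * t" using r by (auto simp: t_def field_simps)
  have "(\<lambda>n. p * \<epsilon> n) \<longlonglongrightarrow> p * 0" by (intro tendsto_intros \<epsilon>)
  then have ev1: "\<forall>\<^sub>F n in sequentially. p * \<epsilon> n < min (1/2) (t / r)"
    by (rule order_tendstoD(2)) (use t J in auto)
  have "(\<lambda>n. c / real n) \<longlonglongrightarrow> 0" by (rule lim_const_over_n)
  then have ev2: "\<forall>\<^sub>F n in sequentially. c / real n < t" by (rule order_tendstoD(2)) (use t in auto)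
  have ev3: "\<forall>\<^sub>F n in sequentially. ereal (gap n) < ereal t"
    using gap t by (intro Limsup_lessD) (auto intro: le_less_trans simp: zero_ereal_def)
  \<comment> \<open>The denominator is d + 1 because d may be zero.\<close>
  have ev4: "\<forall>\<^sub>F n in sequentially. ereal (\<phi> n) < ereal (t / (d + 1))"
    using \<phi> t d by (intro Limsup_lessD) (auto intro: le_less_trans simp: zero_ereal_def)
  have ev5: "\<forall>\<^sub>F n in sequentially. ereal r < ereal (k n)" using r(2) by (rule less_LiminfD)
  from ev1 ev2 ev3 ev4 ev5 eventually_ge_at_top[of 1]
  have "\<forall>\<^sub>F n in sequentially. False"
  proof eventually_elim
    case (elim n)
    have k: "k n > r" and n: "real n > 0" using elim by auto
    have "k n \<le> gap n + c / n + p * \<epsilon> n * k n + d * \<phi> n + J"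
      using bound[OF elim(6)] n by (simp add: add_divide_distrib)
    moreover have "d * \<phi> n \<le> t"
    proof -
      have "d * \<phi> n \<le> d * (t / (d + 1))" using elim d by (intro mult_left_mono) auto
      also have "\<dots> \<le> t" using d t by (simp add: field_simps)
      finally show ?thesis .
    qed
    ultimately have "(1 - p * \<epsilon> n) * k n \<le> J + 3 * t" using elim by (simp add: algebra_simps)
    moreover have "(1 - p * \<epsilon> n) * r \<le> (1 - p * \<epsilon> n) * k n"
      using k elim by (intro mult_left_mono) auto
    moreover have "p * \<epsilon> n * r \<le> t"
    proof -
      have "p * \<epsilon> n * r \<le> (t / r) * r" using elim t J by (intro mult_right_mono) auto
      then show ?thesis using t J by simp
    qed
    ultimately show False using t by (simp add: algebra_simps)
  qed
  then show False by simp
qed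

section \<open>The converse at a fixed block length\<close>

context source_scheme
begin

lemma alphabets:
  "finite (sk_disc_alph S)" "discussion n S \<omega> \<in> sk_disc_alph S"
  "finite (sk_key_alph S)" "sk_key S \<omega> \<in> sk_key_alph S"
  using valid by (auto simp: valid_scheme_def)

lemma discussion_simple: "simple_function N (discussion n S)"
  using alphabets by (intro simple_N) (auto intro: finite_subset[of _ "sk_disc_alph S"])

lemma key_simple: "simple_function N (sk_key S)"
  using alphabets by (intro simple_N) (auto intro: finite_subset[of _ "sk_key_alph S"])

definition "error_prob = measure N {\<omega>. \<exists>i\<in>{1..m}. sk_key S \<omega> \<noteq> sk_dec S i (discussion n S \<omega>) (user_obs n S i \<omega>)}"

definition "block_range i = {xs. set xs \<subseteq> functionals (C i) ` carrier_vec l \<and> length xs = n}"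

text \<open>What the private randomness of user \<open>i\<close> contributes to the key recovery: a function of the
  discussion and the source block. The private randomness itself may have infinite entropy, but there
  are only finitely many such functions.\<close>

definition "strategy i u = (\<lambda>(f, \<beta>). if (f, \<beta>) \<in> sk_disc_alph S \<times> block_range i
   then (let k = sk_dec S i f (u, map (symbol i) \<beta>) in if k \<in> sk_key_alph S then k else sk_key S 0)
   else 0)"

text \<open>Two defaults confine the strategies to functions from a finite set to a finite set: a
  decoded value outside the key alphabet is replaced by the key at sample point 0, which lies in it,
  and arguments outside the finite domain are sent to 0.\<close>

lemma finite_strategy: "finite (range (strategy i))"
proof (rule finite_subset)
  show "range (strategy i) \<subseteq> {g. \<forall>p. (p \<in> sk_disc_alph S \<times> block_range i \<longrightarrow> g p \<in> sk_key_alph S)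
      \<and> (p \<notin> sk_disc_alph S \<times> block_range i \<longrightarrow> g p = 0)}"
    using alphabets by (auto simp: strategy_def Let_def)
  show "finite \<dots>"
    unfolding block_range_def
    by (intro finite_set_of_finite_funs finite_cartesian_product alphabets finite_lists_length_eq finite_imageI finite_carrier_vec)
qed

lemma AE_user_obs:
  assumes i: "i \<in> {1..m}"
  shows "AE \<omega> in N. user_obs n S i \<omega> = (sk_priv S i \<omega>, map (symbol i) (block (functionals (C i)) \<omega>))"
proof -
  have "AE \<omega> in N. obs \<omega> t i = symbol i (functionals (C i) (lift (obs \<omega> t)))" if t: "t < n" for t
  proof (rule AE_obs[OF t])
    show "AE w in M. Z_joint w i = symbol i (functionals (C i) (lift (Z_joint w)))"
      using AE_lift by eventually_elim (use i in metis)
  qed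
  then have "AE \<omega> in N. \<forall>t\<in>{..<n}. obs \<omega> t i = symbol i (functionals (C i) (lift (obs \<omega> t)))"
    by (intro AE_finite_allI) auto
  then show ?thesis
  proof eventually_elim
    case (elim \<omega>)
    have "sk_obs S i t \<omega> = symbol i (functionals (C i) (lift (obs \<omega> t)))" if t: "t < n" for t
    proof -
      have "sk_obs S i t \<omega> = obs \<omega> t i" using t i by (simp add: obs_def)
      also have "\<dots> = symbol i (functionals (C i) (lift (obs \<omega> t)))" using elim t by blast
      finally show ?thesis .
    qed
    then show ?case by (simp add: user_obs_def block_def)
  qed
qed

text \<open>Fano's inequality for the estimate \<open>K'\<close>, which replays the decoder through
  the strategy. Redirecting outputs into the key alphabet adds no error: wherever the decoder is
  right, its output is the key and hence already in the alphabet.\<close>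

lemma key_recovery_entropy:
  assumes i: "i \<in> {1..m}"
  shows "rv_cond_entropy b N (sk_key S)
      (\<lambda>\<omega>. (discussion n S \<omega>, (strategy i (sk_priv S i \<omega>), block (functionals (C i)) \<omega>)))
    \<le> log b 2 + error_prob * log b (card (sk_key_alph S))"
proof -
  let ?Y = "\<lambda>\<omega>. (discussion n S \<omega>, (strategy i (sk_priv S i \<omega>), block (functionals (C i)) \<omega>))"
  define K' where "K' \<omega> = strategy i (sk_priv S i \<omega>) (discussion n S \<omega>, block (functionals (C i)) \<omega>)" for \<omega>
  have br: "block (functionals (C i)) \<omega> \<in> block_range i" for \<omega>
    unfolding block_range_def by (rule subsetD[OF range_block]) simp
  have K': "K' \<omega> = (let k = sk_dec S i (discussion n S \<omega>) (sk_priv S i \<omega>, map (symbol i) (block (functionals (C i)) \<omega>))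
      in if k \<in> sk_key_alph S then k else sk_key S 0)" for \<omega>
    unfolding K'_def strategy_def using alphabets br by simp
  have K'r: "range K' \<subseteq> sk_key_alph S" using alphabets by (auto simp: K' Let_def)
  have K's: "simple_function N K'" using K'r alphabets by (intro simple_N) (auto intro: finite_subset)
  have "simple_function N (\<lambda>\<omega>. strategy i (sk_priv S i \<omega>))"
    using finite_strategy[of i] by (intro simple_N) (auto intro: finite_subset[OF _ finite_strategy])
  then have Y: "simple_function N ?Y"
    by (intro simple_function_Pair discussion_simple block_simple)
  have "rv_cond_entropy b N (sk_key S) ?Y \<le> rv_cond_entropy b N (sk_key S) K'"
    by (rule N.conditional_entropy_antimono[OF key_simple Y K's, of "\<lambda>(f, g, \<beta>). g (f, \<beta>)"]) (simp add: K'_def)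
  also have "\<dots> \<le> log b 2 + measure N {\<omega> \<in> space N. sk_key S \<omega> \<noteq> K' \<omega>} * log b (card (sk_key_alph S))"
    unfolding N.conditional_entropy_eq_diff[OF key_simple K's]
    using K'r alphabets by (intro N.Fano_inequality key_simple K's) auto
  also have "\<dots> \<le> log b 2 + error_prob * log b (card (sk_key_alph S))"
  proof -
    have "measure N {\<omega> \<in> space N. sk_key S \<omega> \<noteq> K' \<omega>} \<le> error_prob"
      unfolding error_prob_def
    proof (rule N.finite_measure_mono_AE)
      show "AE \<omega> in N. \<omega> \<in> {\<omega> \<in> space N. sk_key S \<omega> \<noteq> K' \<omega>} \<longrightarrow>
        \<omega> \<in> {\<omega>. \<exists>i\<in>{1..m}. sk_key S \<omega> \<noteq> sk_dec S i (discussion n S \<omega>) (user_obs n S i \<omega>)}"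
        using AE_user_obs[OF i]
      proof eventually_elim
        case (elim \<omega>)
        have "K' \<omega> = sk_key S \<omega>" if "sk_key S \<omega> = sk_dec S i (discussion n S \<omega>) (user_obs n S i \<omega>)"
          using alphabets(4)[of \<omega>] unfolding K' that elim[symmetric] by (simp add: Let_def)
        then show ?case using i by (intro impI CollectI bexI[of _ i]) auto
      qed
    qed auto
    moreover have "card (sk_key_alph S) \<noteq> 0" using alphabets(3,4) by (metis card_eq_0_iff empty_iff)
    then have "log b (card (sk_key_alph S)) \<ge> 0" using b_gt_1 by simp
    ultimately show ?thesis by (intro add_left_mono mult_right_mono)
  qed
  finally show ?thesis .
qed

lemma W_subset_C: "i \<in> {1..j} \<Longrightarrow> W j \<subseteq> C i"
  by (auto simp: W_def)

lemma conditional_key_entropy_le: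
  assumes m2: "2 \<le> m"
  shows "rv_cond_entropy b N (sk_key S) (discussion n S)
    \<le> m * (log b 2 + error_prob * log b (card (sk_key_alph S)))
      + (m - 1) * log b (card (sk_disc_alph S)) + n * log b (card (W m))"
proof -
  let ?T = "\<lambda>i \<omega>. (strategy i (sk_priv S i \<omega>), block (functionals (C i)) \<omega>)"
  \<comment> \<open>The chain starts at \<open>?T 1\<close>, which contains the strategy of user 1.
    From the second user on the private slot of the common part is constant; as 2 \<le> m, the final
    common part has no private randomness left.\<close>
  define h where "h j = (if j = (1::nat) then strategy 1 else (\<lambda>_ _. 0))" for j
  let ?G = "\<lambda>j \<omega>. (h j (sk_priv S 1 \<omega>), block (functionals (W j)) \<omega>)"
  have fh: "finite (range (h j))" for j using finite_strategy by (auto simp: h_def)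
  have sT: "simple_function N (?T i)" for i
    by (intro simple_function_Pair block_simple simple_N) (rule finite_subset[OF _ finite_strategy], auto)
  have sG: "simple_function N (?G j)" for j
    by (intro simple_function_Pair block_simple simple_N) (rule finite_subset[OF _ fh], auto)
  have "rv_cond_entropy b N (sk_key S) (discussion n S)
      \<le> real m * (log b 2 + error_prob * log b (card (sk_key_alph S)))
        + real (m - 1) * rv_entropy b N (discussion n S) + rv_entropy b N (?G m)"
  proof (rule N.conditional_entropy_common_chain[where T="?T" and G="?G"])
    show "?G 1 = ?T 1" unfolding h_def W_1 by (simp del: One_nat_def)
  next
    fix j assume j: "1 \<le> j" "j < m"
    then have hS: "h (Suc j) = (\<lambda>_ _. 0)" by (simp add: h_def)
    have restr: "block (functionals U) \<omega> = map (\<lambda>g s. if s \<in> U then g s else 0) (block (functionals V) \<omega>)"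
      if "U \<subseteq> V" for U V \<omega>
      using functionals_restrict[OF that] by (simp add: block_def)
    show "\<exists>f. AE \<omega> in N. ?G (Suc j) \<omega> = f (?G j \<omega>)"
      using restr[of "W (Suc j)" "W j"]
      by (intro exI[of _ "\<lambda>(_, \<beta>). (\<lambda>_. 0, map (\<lambda>g s. if s \<in> W (Suc j) then g s else 0) \<beta>)"] AE_I2)
        (simp add: hS W_Suc)
    show "\<exists>f. AE \<omega> in N. ?G (Suc j) \<omega> = f (?T (Suc j) \<omega>)"
      using restr[of "W (Suc j)" "C (Suc j)"]
      by (intro exI[of _ "\<lambda>(_, \<beta>). (\<lambda>_. 0, map (\<lambda>g s. if s \<in> W (Suc j) then g s else 0) \<beta>)"] AE_I2)
        (simp add: hS W_Suc)
    show "rv_entropy b N (?G j) + rv_entropy b N (?T (Suc j))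
        \<le> rv_entropy b N (\<lambda>\<omega>. (?G j \<omega>, ?T (Suc j) \<omega>)) + rv_entropy b N (?G (Suc j))"
      unfolding hS W_Suc
      using j by (intro conditional_independence_block fh finite_strategy W_subspace C_subspace W_subset_C) auto
  qed (use sT sG key_simple discussion_simple key_recovery_entropy m in auto)
  also have "rv_entropy b N (?G m) \<le> n * log b (card (W m))"
  proof -
    have "rv_entropy b N (?G m) \<le> rv_entropy b N (block (functionals (W m)))"
      using m2 by (intro N.entropy_mono[where f="\<lambda>\<beta>. (\<lambda>_. 0, \<beta>)"] sG block_simple) (simp add: h_def)
    also have "\<dots> = n * log b (card (W m))"
      using m by (intro entropy_block_functionals[where i=1] W_subspace W_subset_C) auto
    finally show ?thesis .
  qed
  also have "rv_entropy b N (discussion n S) \<le> log b (card (sk_disc_alph S))"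
    using alphabets by (intro N.entropy_le_log_card discussion_simple) auto
  finally show ?thesis by (simp add: mult_left_mono)
qed

end

section \<open>The converse in the limit\<close>

context linear_source
begin

lemma secrecy_capacity_le:
  assumes m2: "2 \<le> m"
  shows "secrecy_capacity b {1..m} M Z 0 \<le> ereal (log b (card (W m)))"
  unfolding secrecy_capacity_def
proof (rule SUP_least)
  fix S :: "nat \<Rightarrow> 'z sk_scheme"
  assume "S \<in> {S. (\<forall>n. valid_scheme {1..m} M Z n (S n)) \<and> recoverable {1..m} S \<and> secret b S \<and>
      limsup (\<lambda>n. ereal (log b (real (card (sk_disc_alph (S n)))) / real n)) \<le> ereal 0}"
  then have valid: "\<And>n. valid_scheme {1..m} M Z n (S n)" and rec: "recoverable {1..m} S" and sec: "secret b S"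
    and rate: "limsup (\<lambda>n. ereal (log b (real (card (sk_disc_alph (S n)))) / real n)) \<le> 0"
    by (auto simp: zero_ereal_def)
  let ?k = "\<lambda>n. log b (real (card (sk_key_alph (S n))))" and ?f = "\<lambda>n. log b (real (card (sk_disc_alph (S n))))"
  let ?h = "\<lambda>n. rv_cond_entropy b (measure_pmf (sk_law (S n))) (sk_key (S n)) (discussion n (S n))"
  let ?\<epsilon> = "\<lambda>n. measure_pmf.prob (sk_law (S n)) {\<omega>. \<exists>i\<in>{1..m}. sk_key (S n) \<omega> \<noteq>
                       sk_dec (S n) i (discussion n (S n) \<omega>) (user_obs n (S n) i \<omega>)}"
  show "liminf (\<lambda>n. ereal (?k n / real n)) \<le> ereal (log b (card (W m)))"
  proof (rule liminf_le_of_linear_bound[where gap="\<lambda>n. (?k n - ?h n) / real n" and \<phi>="\<lambda>n. ?f n / real n"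
        and \<epsilon>="?\<epsilon>" and p="real m" and c="real m * log b 2" and d="real (m - 1)"])
    fix n :: nat assume n: "n \<ge> 1"
    interpret scheme: source_scheme M b m l Z x A n "S n" by unfold_locales (rule valid)
    have "?h n \<le> m * (log b 2 + ?\<epsilon> n * ?k n) + real (m - 1) * ?f n + n * log b (card (W m))"
      using scheme.conditional_key_entropy_le[OF m2] by (simp only: scheme.error_prob_def)
    then have "?k n \<le> (?k n - ?h n) + m * (log b 2 + ?\<epsilon> n * ?k n) + real (m - 1) * ?f n + n * log b (card (W m))"
      by linarith
    then have "?k n / n \<le> ((?k n - ?h n) + m * (log b 2 + ?\<epsilon> n * ?k n) + real (m - 1) * ?f n + n * log b (card (W m))) / n"
      by (intro divide_right_mono) auto
    also have "\<dots> = (?k n - ?h n) / n + (m * log b 2 + m * ?\<epsilon> n * (?k n / n * n)) / n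
        + real (m - 1) * (?f n / n) + log b (card (W m))"
      using n by (simp add: add_divide_distrib distrib_left)
    finally show "?k n / n \<le> (?k n - ?h n) / n + (m * log b 2 + m * ?\<epsilon> n * (?k n / n * n)) / n
        + real (m - 1) * (?f n / n) + log b (card (W m))" .
  next
    have "vec_subspace l (W m)" using m by (intro W_subspace) auto
    then have "card (W m) \<noteq> 0" using vec_subspaceD(2) vec_subspace_finite by (metis card_eq_0_iff empty_iff)
    then show "0 \<le> log b (card (W m))" using b_gt_1 by simp
  qed (use rate sec rec in \<open>auto simp: secret_def recoverable_def\<close>)
qed

end

section \<open>Achievability\<close>

lemma indep_vars_pmfI:
  assumes "\<And>J B. J \<subseteq> I \<Longrightarrow> J \<noteq> {} \<Longrightarrow> finite J \<Longrightarrow>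
    measure_pmf.prob p (\<Inter>j\<in>J. X j -` B j) = (\<Prod>j\<in>J. measure_pmf.prob p (X j -` B j))"
  shows "prob_space.indep_vars (measure_pmf p) (\<lambda>_. count_space UNIV) X I"
  unfolding prob_space.indep_vars_def2[OF measure_pmf.prob_space_axioms]
    prob_space.indep_sets_def[OF measure_pmf.prob_space_axioms]
proof (intro conjI ballI allI impI)
  fix J E assume J: "J \<subseteq> I" "J \<noteq> {}" "finite J"
    and "E \<in> Pi J (\<lambda>i. {X i -` A \<inter> space (measure_pmf p) |A. A \<in> sets (count_space UNIV)})"
  then have "\<forall>j\<in>J. \<exists>A. E j = X j -` A" by (simp add: Pi_iff)
  from bchoice[OF this] obtain B where B: "\<And>j. j \<in> J \<Longrightarrow> E j = X j -` B j" by blast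
  have "(\<Inter> (E ` J)) = (\<Inter>j\<in>J. X j -` B j)"
    "(\<Prod>j\<in>J. measure_pmf.prob p (E j)) = (\<Prod>j\<in>J. measure_pmf.prob p (X j -` B j))"
    using B by (simp_all cong: INF_cong prod.cong)
  then show "measure_pmf.prob p (\<Inter> (E ` J)) = (\<Prod>j\<in>J. measure_pmf.prob p (E j))"
    using assms[OF J, of B] by (simp only:)
qed simp_all

lemma indep_vars_const_pmf:
  "prob_space.indep_vars (measure_pmf p) (\<lambda>_. count_space UNIV) (\<lambda>i _. c i) I"
proof (rule indep_vars_pmfI)
  fix J B assume J: "J \<subseteq> I" "J \<noteq> {}" "finite J"
  show "measure_pmf.prob p (\<Inter>j\<in>J. (\<lambda>_. c j) -` B j) = (\<Prod>j\<in>J. measure_pmf.prob p ((\<lambda>_. c j) -` B j))"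
  proof (cases "\<forall>j\<in>J. c j \<in> B j")
    case True
    then have eq: "(\<Inter>j\<in>J. (\<lambda>_. c j) -` B j) = UNIV" by auto
    have "(\<Prod>j\<in>J. measure_pmf.prob p ((\<lambda>_. c j) -` B j)) = (\<Prod>j\<in>J. 1)"
      using True by (intro prod.cong) auto
    then show ?thesis unfolding eq by simp
  next
    case False
    then obtain j where j: "j \<in> J" "c j \<notin> B j" by auto
    then have "(\<Inter>j\<in>J. (\<lambda>_. c j) -` B j) = {}" "(\<lambda>_. c j) -` B j = {}" by auto
    then have "measure_pmf.prob p (\<Inter>j\<in>J. (\<lambda>_. c j) -` B j) = 0" "measure_pmf.prob p ((\<lambda>_. c j) -` B j) = 0"
      by (metis measure_empty)+
    with j J show ?thesis by (metis prod_zero)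
  qed
qed

lemma indep_vars_map_pmf:
  assumes "prob_space.indep_vars (measure_pmf (map_pmf g p)) (\<lambda>_. count_space UNIV) X I"
  shows "prob_space.indep_vars (measure_pmf p) (\<lambda>_. count_space UNIV) (\<lambda>i \<omega>. X i (g \<omega>)) I"
proof (rule indep_vars_pmfI)
  fix J B assume J: "J \<subseteq> I" "J \<noteq> {}" "finite J"
  have "measure_pmf.prob (map_pmf g p) (\<Inter>j\<in>J. X j -` B j \<inter> space (measure_pmf (map_pmf g p)))
      = (\<Prod>j\<in>J. measure_pmf.prob (map_pmf g p) (X j -` B j \<inter> space (measure_pmf (map_pmf g p))))"
    using J by (intro prob_space.indep_varsD[OF measure_pmf.prob_space_axioms assms]) auto
  moreover have eq: "(\<Inter>j\<in>J. {\<omega>. X j (f \<omega>) \<in> B j}) = {\<omega>. \<forall>j\<in>J. X j (f \<omega>) \<in> B j}" for f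
    by auto
  ultimately show "measure_pmf.prob p (\<Inter>j\<in>J. (\<lambda>\<omega>. X j (g \<omega>)) -` B j)
      = (\<Prod>j\<in>J. measure_pmf.prob p ((\<lambda>\<omega>. X j (g \<omega>)) -` B j))"
    by (simp add: vimage_def eq)
qed

text \<open>A law with finitely many values is discrete, as the law of the sample points of a scheme
  has to be.\<close>

lemma (in information_space) pmf_of_simple_function:
  assumes X: "simple_function M X"
  shows "\<exists>D. measure_pmf D = distr M (count_space UNIV) X"
proof -
  have m: "X \<in> measurable M (count_space UNIV)" by (rule measurable_simple_function[OF X])
  let ?D = "distr M (count_space UNIV) X"
  have "AE v in ?D. measure ?D {v} \<noteq> 0"
    using AE_prob_fiber[OF X] by (subst AE_distr_iff[OF m]) (auto simp: measure_distr[OF m])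
  moreover have "prob_space ?D" by (rule prob_space_distr[OF m])
  ultimately have "measure_pmf (Abs_pmf ?D) = ?D" by (intro Abs_pmf_inverse) auto
  then show ?thesis by blast
qed

section \<open>A key without discussion\<close>

context linear_source
begin

definition "key_symbols = functionals (W m) ` carrier_vec l"

text \<open>The symbol of the common part read off from the source of user \<open>i\<close>, with a default value
  for source symbols of probability zero.\<close>

definition "common_symbol i z = (let g = (\<lambda>s. if s \<in> W m then coordinates i z s else 0) in
   if g \<in> key_symbols then g else functionals (W m) (0\<^sub>v l))"

definition "key_words n = {xs. set xs \<subseteq> key_symbols \<and> length xs = n}"

definition "Z_pmf = (SOME D. measure_pmf D = distr M (count_space UNIV) Z_joint)"

definition "Z_block_pmf n = Pi_pmf {..<n} undefined (\<lambda>_::nat. Z_pmf)"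

text \<open>Sample points have to be naturals, so a point is the number of a whole source block in
  the countable support of its law, and the observations decode it. Words of key symbols are
  numbered likewise. Every message is 0, which leaves a discussion alphabet of one element.\<close>

definition common_scheme :: "nat \<Rightarrow> 'z sk_scheme" where
  "common_scheme n = \<lparr>
     sk_law = map_pmf (to_nat_on (set_pmf (Z_block_pmf n))) (Z_block_pmf n),
     sk_priv = (\<lambda>_ _. 0),
     sk_obs = (\<lambda>i t \<omega>. from_nat_into (set_pmf (Z_block_pmf n)) \<omega> t i),
     sk_speaker = (\<lambda>_. 1),
     sk_enc = (\<lambda>_ _ _. 0),
     sk_disc_alph = {\<lambda>_. 0},
     sk_key = (\<lambda>\<omega>. to_nat_on (key_words n)
        (map (\<lambda>t. common_symbol 1 (from_nat_into (set_pmf (Z_block_pmf n)) \<omega> t 1)) [0..<n])),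
     sk_key_alph = to_nat_on (key_words n) ` key_words n,
     sk_dec = (\<lambda>i _ (_, zs). to_nat_on (key_words n) (map (common_symbol i) zs)) \<rparr>"

lemma Z_pmf: "measure_pmf Z_pmf = distr M (count_space UNIV) Z_joint"
  unfolding Z_pmf_def by (rule someI_ex[OF pmf_of_simple_function[OF Z_joint_simple]])

lemma Z_pmf_restrict: "map_pmf (\<lambda>z. restrict z {1..m}) Z_pmf = Z_pmf"
proof -
  have "measure_pmf (map_pmf (\<lambda>z. restrict z {1..m}) Z_pmf)
      = distr (distr M (count_space UNIV) Z_joint) (count_space UNIV) (\<lambda>z. restrict z {1..m})"
    by (simp add: map_pmf_rep_eq Z_pmf)
  also have "\<dots> = distr M (count_space UNIV) ((\<lambda>z. restrict z {1..m}) \<circ> Z_joint)"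
    using Z_joint_measurable by (intro distr_distr) auto
  also have "(\<lambda>z. restrict z {1..m}) \<circ> Z_joint = Z_joint"
    by (simp add: fun_eq_iff Z_joint_def)
  finally show ?thesis by (simp only: Z_pmf[symmetric] measure_pmf_inject)
qed

lemma common_scheme_law:
  "map_pmf (from_nat_into (set_pmf (Z_block_pmf n))) (sk_law (common_scheme n)) = Z_block_pmf n"
proof -
  have "map_pmf (from_nat_into (set_pmf (Z_block_pmf n))) (sk_law (common_scheme n))
      = map_pmf (\<lambda>y. from_nat_into (set_pmf (Z_block_pmf n)) (to_nat_on (set_pmf (Z_block_pmf n)) y)) (Z_block_pmf n)"
    by (simp add: common_scheme_def map_pmf_comp)
  also have "\<dots> = map_pmf (\<lambda>y. y) (Z_block_pmf n)"
    by (intro map_pmf_cong) (auto intro!: from_nat_into_to_nat_on countable_set_pmf)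
  finally show ?thesis by simp
qed

lemma finite_key_words: "finite (key_words n)"
  unfolding key_words_def key_symbols_def
  by (rule finite_lists_length_eq[OF finite_imageI[OF finite_carrier_vec]])

lemma card_key_words: "card (key_words n) = card (W m) ^ n"
proof -
  have "vec_subspace l (W m)" using m by (intro W_subspace) auto
  then have "card key_symbols = card (W m)"
    unfolding key_symbols_def by (rule card_functionals_image)
  then show ?thesis
    unfolding key_words_def using finite_carrier_vec by (subst card_lists_length_eq) (auto simp: key_symbols_def)
qed

lemma common_symbol_mem: "common_symbol i z \<in> key_symbols"
proof -
  have "functionals (W m) (0\<^sub>v l) \<in> key_symbols"
    unfolding key_symbols_def by (rule imageI) simp
  then show ?thesis unfolding common_symbol_def Let_def by (simp only: split: if_split) blast
qed

lemma inj_code: "inj_on (to_nat_on (key_words n)) (key_words n)"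
  by (rule inj_on_to_nat_on[OF countable_finite[OF finite_key_words]])

lemma discussion_common_scheme: "discussion n (common_scheme n) = (\<lambda>_ _. 0)"
proof -
  have "message (\<lambda>_ _ _. 0) sp y t = 0" for sp t and y :: "nat \<Rightarrow> nat \<times> 'z list"
    by (subst message.simps) (rule refl)
  then show ?thesis by (simp add: discussion_def common_scheme_def fun_eq_iff)
qed

lemma valid_common_scheme: "valid_scheme {1..m} M Z n (common_scheme n)"
proof -
  let ?d = "from_nat_into (set_pmf (Z_block_pmf n))" and ?law = "sk_law (common_scheme n)"
  have obs: "sk_obs (common_scheme n) i t \<omega> = ?d \<omega> t i" for i t \<omega> by (simp add: common_scheme_def)
  have priv: "sk_priv (common_scheme n) = (\<lambda>_ _. 0)" by (simp add: common_scheme_def)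
  have "prob_space.indep_vars (measure_pmf (Z_block_pmf n)) (\<lambda>_. count_space UNIV) (\<lambda>t y. y t) {..<n}"
    unfolding Z_block_pmf_def by (rule indep_vars_Pi_pmf) simp
  then have "prob_space.indep_vars (measure_pmf (map_pmf ?d ?law)) (\<lambda>_. count_space UNIV) (\<lambda>t y. restrict (y t) {1..m}) {..<n}"
    unfolding common_scheme_law
    using prob_space.indep_vars_compose2[OF measure_pmf.prob_space_axioms,
        of "Z_block_pmf n" "\<lambda>_. count_space UNIV" "\<lambda>t y. y t" "{..<n}" "\<lambda>_ z. restrict z {1..m}" "\<lambda>_. count_space UNIV"]
    by simp
  then have ind: "prob_space.indep_vars (measure_pmf ?law) (\<lambda>_. count_space UNIV)
      (\<lambda>t \<omega>. \<lambda>i\<in>{1..m}. sk_obs (common_scheme n) i t \<omega>) {..<n}"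
    unfolding obs by (rule indep_vars_map_pmf)
  have distr: "distr (measure_pmf ?law) (count_space UNIV) (\<lambda>\<omega>. \<lambda>i\<in>{1..m}. sk_obs (common_scheme n) i t \<omega>)
      = distr M (count_space UNIV) (\<lambda>\<omega>. \<lambda>i\<in>{1..m}. Z i \<omega>)" if t: "t < n" for t
  proof -
    have "map_pmf (\<lambda>\<omega>. \<lambda>i\<in>{1..m}. sk_obs (common_scheme n) i t \<omega>) ?law
        = map_pmf (\<lambda>y. restrict (y t) {1..m}) (map_pmf ?d ?law)"
      by (simp add: obs map_pmf_comp)
    also have "\<dots> = map_pmf (\<lambda>z. restrict z {1..m}) (map_pmf (\<lambda>y. y t) (Z_block_pmf n))"
      by (simp add: common_scheme_law map_pmf_comp)
    also have "map_pmf (\<lambda>y. y t) (Z_block_pmf n) = Z_pmf"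
      using t by (simp add: Z_block_pmf_def Pi_pmf_component)
    also note Z_pmf_restrict
    finally have eq: "map_pmf (\<lambda>\<omega>. \<lambda>i\<in>{1..m}. sk_obs (common_scheme n) i t \<omega>) ?law = Z_pmf" .
    show ?thesis
      using arg_cong[OF eq, of measure_pmf] unfolding map_pmf_rep_eq Z_pmf Z_joint_def[abs_def] .
  qed
  have "set (map (\<lambda>t. common_symbol 1 (?d \<omega> t 1)) [0..<n]) \<subseteq> key_symbols" for \<omega>
    using common_symbol_mem by auto
  then have key: "sk_key (common_scheme n) \<omega> \<in> sk_key_alph (common_scheme n)" for \<omega>
    by (auto simp: common_scheme_def key_words_def intro!: imageI)
  show ?thesis
    unfolding valid_scheme_def discussion_common_scheme
    using ind distr m key finite_key_words[of n]
    by (auto simp: priv indep_vars_const_pmf pair_return_pmf1 map_pmf_comp common_scheme_def)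
qed

text \<open>The scheme is itself a \<open>source_scheme\<close>, so the block entropies of the
  converse apply to it. Almost surely every user reads off the block of functionals on
  \<open>W m\<close>, of entropy n log |W m|. This is also the logarithm of the size of the key
  alphabet, so the secrecy gap is zero at every block length.\<close>

lemma common_scheme_exact:
  shows common_scheme_key: "AE \<omega> in measure_pmf (sk_law (common_scheme n)). \<forall>i\<in>{1..m}.
      sk_dec (common_scheme n) i (discussion n (common_scheme n) \<omega>) (user_obs n (common_scheme n) i \<omega>)
        = sk_key (common_scheme n) \<omega>"
    and common_scheme_entropy: "rv_cond_entropy b (measure_pmf (sk_law (common_scheme n)))
      (sk_key (common_scheme n)) (discussion n (common_scheme n)) = n * log b (card (W m))"
proof -
  interpret scheme: source_scheme M b m l Z x A n "common_scheme n"
    by unfold_locales (rule valid_common_scheme)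
  let ?d = "from_nat_into (set_pmf (Z_block_pmf n))" and ?code = "to_nat_on (key_words n)"
  let ?B = "scheme.block (functionals (W m))"
  have obs: "sk_obs (common_scheme n) i t \<omega> = ?d \<omega> t i" for i t \<omega> by (simp add: common_scheme_def)
  \<comment> \<open>Off a null set the test in \<open>common_symbol\<close> succeeds and its default
    value is not reached.\<close>
  have step: "AE \<omega> in scheme.N. \<forall>i\<in>{1..m}. common_symbol i (scheme.obs \<omega> t i) = functionals (W m) (lift (scheme.obs \<omega> t))"
    if t: "t < n" for t
  proof (rule scheme.AE_obs[OF t])
    show "AE w in M. \<forall>i\<in>{1..m}. common_symbol i (Z_joint w i) = functionals (W m) (lift (Z_joint w))"
      using AE_lift
    proof eventually_elim
      case (elim w)
      show ?case
      proof
        fix i assume i: "i \<in> {1..m}"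
        have eq: "coordinates i (Z_joint w i) = functionals (C i) (lift (Z_joint w))" using elim i by metis
        have "(\<lambda>s. if s \<in> W m then coordinates i (Z_joint w i) s else 0) = functionals (W m) (lift (Z_joint w))"
          unfolding functionals_restrict[OF scheme.W_subset_C[OF i]] eq ..
        moreover have "functionals (W m) (lift (Z_joint w)) \<in> key_symbols"
          unfolding key_symbols_def using lift_carrier by blast
        ultimately show "common_symbol i (Z_joint w i) = functionals (W m) (lift (Z_joint w))"
          by (simp only: common_symbol_def Let_def if_True)
      qed
    qed
  qed
  have "AE \<omega> in scheme.N. \<forall>t\<in>{..<n}. \<forall>i\<in>{1..m}.
      common_symbol i (scheme.obs \<omega> t i) = functionals (W m) (lift (scheme.obs \<omega> t))"
    by (rule AE_finite_allI[OF finite_lessThan step]) simp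
  then have words: "AE \<omega> in scheme.N. \<forall>i\<in>{1..m}. map (\<lambda>t. common_symbol i (?d \<omega> t i)) [0..<n] = ?B \<omega>"
  proof eventually_elim
    case (elim \<omega>)
    have "common_symbol i (?d \<omega> t i) = functionals (W m) (lift (scheme.obs \<omega> t))" if "i \<in> {1..m}" "t < n" for i t
    proof -
      have "scheme.obs \<omega> t i = ?d \<omega> t i" using that by (simp add: scheme.obs_def obs)
      with elim that show ?thesis by (metis lessThan_iff)
    qed
    then show ?case by (auto simp: scheme.block_def)
  qed
  have key: "sk_key (common_scheme n) \<omega> = ?code (map (\<lambda>t. common_symbol 1 (?d \<omega> t 1)) [0..<n])" for \<omega>
    by (simp add: common_scheme_def)
  have dec: "sk_dec (common_scheme n) i f (user_obs n (common_scheme n) i \<omega>)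
      = ?code (map (\<lambda>t. common_symbol i (?d \<omega> t i)) [0..<n])" for i f \<omega>
    by (simp add: common_scheme_def user_obs_def comp_def)
  show "AE \<omega> in scheme.N. \<forall>i\<in>{1..m}.
      sk_dec (common_scheme n) i (discussion n (common_scheme n) \<omega>) (user_obs n (common_scheme n) i \<omega>)
        = sk_key (common_scheme n) \<omega>"
    using words
  proof eventually_elim
    case (elim \<omega>)
    have "1 \<in> {1..m}" using m by simp
    with elim show ?case unfolding key dec by metis
  qed
  have Bw: "?B \<omega> \<in> key_words n" for \<omega>
    unfolding key_words_def key_symbols_def by (rule subsetD[OF scheme.range_block]) simp
  have kB: "AE \<omega> in scheme.N. sk_key (common_scheme n) \<omega> = ?code (?B \<omega>)"
    using words by eventually_elim (use m in \<open>simp add: key\<close>)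
  \<comment> \<open>The numbering is injective on words, so key and block determine each
    other.\<close>
  then have Bk: "AE \<omega> in scheme.N. ?B \<omega> = the_inv_into (key_words n) ?code (sk_key (common_scheme n) \<omega>)"
    by eventually_elim (simp add: the_inv_into_f_f[OF inj_code Bw])
  have "rv_entropy b scheme.N (sk_key (common_scheme n)) = rv_entropy b scheme.N ?B"
    by (rule scheme.N.entropy_eq_AE[OF scheme.key_simple scheme.block_simple kB Bk])
  also have "\<dots> = n * log b (card (W m))"
    using m by (intro scheme.entropy_block_functionals[where i=1] W_subspace scheme.W_subset_C) auto
  finally have "rv_entropy b scheme.N (sk_key (common_scheme n)) = n * log b (card (W m))" .
  moreover have "rv_entropy b scheme.N (\<lambda>\<omega>. (sk_key (common_scheme n) \<omega>, \<lambda>_::nat. 0::nat))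
      = rv_entropy b scheme.N (sk_key (common_scheme n))"
    by (intro antisym scheme.N.entropy_mono_kernel simple_function_Pair scheme.key_simple simple_function_const) auto
  moreover note scheme.N.conditional_entropy_eq_diff[OF scheme.key_simple simple_function_const, of "\<lambda>_::nat. 0::nat"]
    scheme.N.entropy_const[of "\<lambda>_::nat. 0::nat"]
  ultimately show "rv_cond_entropy b scheme.N (sk_key (common_scheme n)) (discussion n (common_scheme n)) = n * log b (card (W m))"
    unfolding discussion_common_scheme by linarith
qed

lemma secrecy_capacity_ge: "ereal (log b (card (W m))) \<le> secrecy_capacity b {1..m} M Z 0"
proof -
  have card: "log b (real (card (sk_key_alph (common_scheme n)))) = n * log b (card (W m))" for n
  proof -
    have "card (sk_key_alph (common_scheme n)) = card (W m) ^ n"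
      using card_image[OF inj_code] by (simp add: common_scheme_def card_key_words)
    moreover have "card (W m) > 0"
      using m vec_subspaceD(2)[OF W_subspace] vec_subspace_finite[OF W_subspace]
      by (metis card_gt_0_iff empty_iff order_refl)
    ultimately show ?thesis by (simp add: log_nat_power)
  qed
  have "recoverable {1..m} common_scheme"
  proof -
    have "measure_pmf.prob (sk_law (common_scheme n)) {\<omega>. \<exists>i\<in>{1..m}. sk_key (common_scheme n) \<omega> \<noteq>
        sk_dec (common_scheme n) i (discussion n (common_scheme n) \<omega>) (user_obs n (common_scheme n) i \<omega>)} = 0" for n
    proof -
      have "AE \<omega> in measure_pmf (sk_law (common_scheme n)). \<omega> \<notin> {\<omega>. \<exists>i\<in>{1..m}. sk_key (common_scheme n) \<omega> \<noteq>
        sk_dec (common_scheme n) i (discussion n (common_scheme n) \<omega>) (user_obs n (common_scheme n) i \<omega>)}"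
        using common_scheme_key[of n] by eventually_elim force
      then show ?thesis by (subst measure_pmf.prob_eq_0) auto
    qed
    then show ?thesis by (simp add: recoverable_def)
  qed
  moreover have "secret b common_scheme"
    unfolding secret_def card common_scheme_entropy by (simp add: Limsup_const zero_ereal_def)
  moreover have "limsup (\<lambda>n. ereal (log b (real (card (sk_disc_alph (common_scheme n)))) / real n)) \<le> ereal 0"
    by (simp add: common_scheme_def Limsup_const)
  ultimately have mem: "common_scheme \<in> {S. (\<forall>n. valid_scheme {1..m} M Z n (S n)) \<and> recoverable {1..m} S \<and> secret b S \<and>
      limsup (\<lambda>n. ereal (log b (real (card (sk_disc_alph (S n)))) / real n)) \<le> ereal 0}"
    using valid_common_scheme by blast
  have "liminf (\<lambda>n. ereal (log b (real (card (sk_key_alph (common_scheme n)))) / real n))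
      = liminf (\<lambda>n::nat. ereal (log b (card (W m))))"
    unfolding card
  \<comment> \<open>The rates equal the constant only from index 1 on, where n cancels.\<close>
  proof (rule Liminf_eq)
    show "\<forall>\<^sub>F n in sequentially. ereal (real n * log b (card (W m)) / real n) = ereal (log b (card (W m)))"
      using eventually_gt_at_top[of 0] by eventually_elim simp
  qed
  also have "\<dots> = ereal (log b (card (W m)))" by (simp add: Liminf_const)
  finally have "liminf (\<lambda>n. ereal (log b (real (card (sk_key_alph (common_scheme n)))) / real n))
      = ereal (log b (card (W m)))" .
  then show ?thesis
    unfolding secrecy_capacity_def by (intro SUP_upper2[OF mem]) (rule eq_refl[OF sym])
qed

end

theorem theorem2:
  fixes M :: "'w measure" and b :: real and m l :: nat
    and Z :: "nat \<Rightarrow> 'w \<Rightarrow> 'z"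
    and x :: "'w \<Rightarrow> 'q :: {field, finite} vec"
    and A :: "nat \<Rightarrow> 'q mat"
  assumes "information_space M b"
    and "m \<ge> 2"
    and "finite_linear_source b {1..m} M Z l x A"
  shows "secrecy_capacity b {1..m} M Z 0 = J_GK b {1..m} M Z \<and>
    (\<exists>B. dim_row B = l \<and> column_space l B = (\<Inter>i\<in>{1..m}. column_space l (A i))) \<and>
    (\<forall>B. dim_row B = l \<and> column_space l B = (\<Inter>i\<in>{1..m}. column_space l (A i)) \<longrightarrow>
      GK_optimal b {1..m} M Z (\<lambda>\<omega>. row_times (x \<omega>) B) \<and>
      {S. is_arg_max (subspace_dim l)
            (\<lambda>S. vec_subspace l S \<and> (\<forall>i\<in>{1..m}. S \<subseteq> column_space l (A i))) S}
        = {column_space l B})"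
proof -
  interpret information_space M b by (rule assms(1))
  interpret linear_source M b m l Z x A
    by unfold_locales (use assms in auto)
  have W: "W m = (\<Inter>i\<in>{1..m}. column_space l (A i))" by (simp add: W_def C_def)
  have Wsub: "vec_subspace l (W m)" using m by (intro W_subspace) auto
  have capacity: "secrecy_capacity b {1..m} M Z 0 = J_GK b {1..m} M Z"
    unfolding J_GK_eq by (intro antisym secrecy_capacity_le[OF assms(2)] secrecy_capacity_ge)
  have optimal: "GK_optimal b {1..m} M Z (\<lambda>\<omega>. row_times (x \<omega>) B)"
    if "dim_row B = l" "column_space l B = W m" for B
    unfolding GK_optimal_def J_GK_eq using row_times_common[OF that] by simp
  let ?P = "\<lambda>S. vec_subspace l S \<and> (\<forall>i\<in>{1..m}. S \<subseteq> column_space l (A i))"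
  \<comment> \<open>The constraint describes the subspaces of \<open>W m\<close>, itself included;
    one of the same dimension is all of \<open>W m\<close>, so the maximiser is unique.\<close>
  have P: "?P S \<longleftrightarrow> vec_subspace l S \<and> S \<subseteq> W m" for S unfolding W by blast
  have "is_arg_max (subspace_dim l) ?P S \<longleftrightarrow> S = W m" for S
  proof
    assume "is_arg_max (subspace_dim l) ?P S"
    then have S: "vec_subspace l S" "S \<subseteq> W m" "\<not> subspace_dim l (W m) > subspace_dim l S"
      unfolding is_arg_max_def P using Wsub by auto
    with subspace_dim_mono[OF S(1) Wsub S(2)] show "S = W m" by simp
  next
    assume "S = W m"
    then show "is_arg_max (subspace_dim l) ?P S"
      unfolding is_arg_max_def P using Wsub subspace_dim_mono(1)[OF _ Wsub] by (auto simp: not_less)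
  qed
  then have "{S. is_arg_max (subspace_dim l) ?P S} = {W m}" by blast
  then show ?thesis
    using capacity optimal subspace_as_column_space[OF Wsub] unfolding W by auto
qed

end
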